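(* Let $R=(r_{ij})$ be a real symmetric $n\times n$ matrix with zero diagonal and $\rho(|R|)<1$, let $G$ be its graph, let $\alpha_{ij}$ be the Gaussian belief propagation messages and $Z^{\mathrm{bp}}$ the belief-propagation determinant estimate (all defined in the context). Then $$Z^{\mathrm{bp}}=\prod_{\ell\in\mathcal{L}_\emptyset}(1-R^\ell)^{-1},$$ where the product is over the set $\mathcal{L}_\emptyset$ of all totally backtracking orbits of $G$.
   Context: $|R|=(|r_{ij}|)$ is the entrywise absolute value and $\rho$ the spectral radius. $G$ is the graph on $V=\{1,\dots,n\}$ with undirected edge $\{i,j\}$ whenever $r_{ij}\neq0$; $\partial i$ is the set of neighbours of $i$; each undirected edge gives two directed edges $(ij),(ji)$. A walk is a sequence of vertices $(w_0,\dots,w_L)$ with $\{w_t,w_{t+1}\}\in G$; its steps are $(w_tw_{t+1})$; it is closed if $L\ge1$, $w_0=w_L$; a closed walk is primitive if it is not an $m$-fold concatenation ($m\ge2$) of a shorter closed walk. An orbit is an equivalence class of closed primitive walks under cyclic shifts. $n_{ij}(\ell)$ is the number of occurrences of step $(ij)$ in orbit $\ell$ and $R^\ell=\prod r_{ij}^{n_{ij}(\ell)}$. An orbit is regarded as a cyclic sequence of steps (the step following $(w_{L-1}w_L)$ is $(w_0w_1)$); a backtracking pair is a pair of cyclically consecutive steps of the form $(ij)(ji)$. Repeatedly deleting backtracking pairs (cyclically) until none remain gives the irreducible core of the orbit; the orbit is totally backtracking if its irreducible core is empty. GaBP messages: for each directed edge $(ij)$ of $G$, $\alpha_{ij}=\lim_{t\to\infty}\alpha^{(t)}_{ij}$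 where $\alpha^{(0)}_{ij}=0$ and $\alpha^{(t+1)}_{ij}=r_{ij}^2\,(1-\sum_{k\in\partial i\setminus j}\alpha^{(t)}_{ki})^{-1}$ (when $\rho(|R|)<1$ this iteration converges and $1-\alpha_{i\setminus j}>0$). Write $\alpha_{i\setminus j}=\sum_{k\in\partial i\setminus j}\alpha_{ki}$. Define $Z_i^{\mathrm{bp}}=(1-\sum_{k\in\partial i}\alpha_{ki})^{-1}$, and for each edge $\{i,j\}$, $Z_{ij}^{\mathrm{bp}}=\det\begin{pmatrix}1-\alpha_{i\setminus j} & -r_{ij}\\ -r_{ij} & 1-\alpha_{j\setminus i}\end{pmatrix}^{-1}$. Then $Z^{\mathrm{bp}}=\prod_{i\in V}Z_i^{\mathrm{bp}}\prod_{\{i,j\}\in G}\frac{Z_{ij}^{\mathrm{bp}}}{Z_i^{\mathrm{bp}}Z_j^{\mathrm{bp}}}$. *)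

theory Defs
  imports "HOL-Analysis.Analysis" "Jordan_Normal_Form.Spectral_Radius"
begin

text \<open>Vertices are 0,...,n-1 (n = dim_row R), i.e. the paper's 1..n shifted by one.\<close>

definition adj :: "real mat \<Rightarrow> nat \<Rightarrow> nat \<Rightarrow> bool" where
  "adj R i j \<longleftrightarrow> i < dim_row R \<and> j < dim_row R \<and> R $$ (i,j) \<noteq> 0"

definition nbrs :: "real mat \<Rightarrow> nat \<Rightarrow> nat set" where
  "nbrs R i = {k. adj R i k}"

definition abs_mat :: "real mat \<Rightarrow> real mat" where
  "abs_mat R = map_mat abs R"

definition walk :: "real mat \<Rightarrow> nat list \<Rightarrow> bool" where
  "walk R w \<longleftrightarrow> w \<noteq> [] \<and> (\<forall>t. Suc t < length w \<longrightarrow> adj R (w ! t) (w ! Suc t))"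

definition closed_walk :: "real mat \<Rightarrow> nat list \<Rightarrow> bool" where
  "closed_walk R w \<longleftrightarrow> walk R w \<and> length w \<ge> 2 \<and> hd w = last w"

definition walk_pow :: "nat list \<Rightarrow> nat \<Rightarrow> nat list" where
  "walk_pow u m = hd u # concat (replicate m (tl u))"

definition primitive_walk :: "real mat \<Rightarrow> nat list \<Rightarrow> bool" where
  "primitive_walk R w \<longleftrightarrow> closed_walk R w \<and>
     \<not> (\<exists>u m. m \<ge> 2 \<and> closed_walk R u \<and> length u < length w \<and> w = walk_pow u m)"

text \<open>Cyclic shift of a closed walk (w_0,...,w_L) by k < L:
  (w_k,...,w_L=w_0,w_1,...,w_k).\<close>
definition cyc_shift :: "nat \<Rightarrow> nat list \<Rightarrow> nat list" where
  "cyc_shift k w = drop k w @ tl (take (Suc k) w)"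

definition orbit_of :: "nat list \<Rightarrow> nat list set" where
  "orbit_of w = {cyc_shift k w | k. k < length w - 1}"

definition orbits :: "real mat \<Rightarrow> nat list set set" where
  "orbits R = {orbit_of w | w. primitive_walk R w}"

definition orbit_rep :: "nat list set \<Rightarrow> nat list" where
  "orbit_rep l = (SOME w. w \<in> l)"

definition steps :: "nat list \<Rightarrow> (nat \<times> nat) list" where
  "steps w = zip (butlast w) (tl w)"

definition step_count :: "nat list set \<Rightarrow> nat \<Rightarrow> nat \<Rightarrow> nat" where
  "step_count l i j = count_list (steps (orbit_rep l)) (i, j)"

definition orbit_weight :: "real mat \<Rightarrow> nat list set \<Rightarrow> real" where
  "orbit_weight R l = (\<Prod>(i,j)\<in>{(i,j). adj R i j}. (R $$ (i,j)) ^ step_count l i j)"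

text \<open>One deletion of a backtracking pair in a cyclic sequence of steps:
  either two consecutive steps (ij)(ji) inside the list, or the cyclic pair
  formed by the last step (ij) and the first step (ji).\<close>
inductive bt_del :: "(nat \<times> nat) list \<Rightarrow> (nat \<times> nat) list \<Rightarrow> bool" where
  inner: "bt_del (a @ [(i,j), (j,i)] @ b) (a @ b)"
| wrap: "bt_del ([(j,i)] @ m @ [(i,j)]) m"

definition irreducible_core :: "(nat \<times> nat) list \<Rightarrow> (nat \<times> nat) list \<Rightarrow> bool" where
  "irreducible_core s c \<longleftrightarrow> bt_del\<^sup>*\<^sup>* s c \<and> (\<nexists>c'. bt_del c c')"

definition totally_backtracking :: "nat list set \<Rightarrow> bool" where
  "totally_backtracking l \<longleftrightarrow> irreducible_core (steps (orbit_rep l)) []"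

definition tb_orbits :: "real mat \<Rightarrow> nat list set set" where
  "tb_orbits R = {l \<in> orbits R. totally_backtracking l}"

fun alpha_iter :: "real mat \<Rightarrow> nat \<Rightarrow> nat \<Rightarrow> nat \<Rightarrow> real" where
  "alpha_iter R 0 i j = 0"
| "alpha_iter R (Suc t) i j =
     (R $$ (i,j))\<^sup>2 * inverse (1 - (\<Sum>k\<in>nbrs R i - {j}. alpha_iter R t k i))"

definition alpha :: "real mat \<Rightarrow> nat \<Rightarrow> nat \<Rightarrow> real" where
  "alpha R i j = lim (\<lambda>t. alpha_iter R t i j)"

definition alpha_excl :: "real mat \<Rightarrow> nat \<Rightarrow> nat \<Rightarrow> real" where
  "alpha_excl R i j = (\<Sum>k\<in>nbrs R i - {j}. alpha R k i)"

definition Z_node :: "real mat \<Rightarrow> nat \<Rightarrow> real" where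
  "Z_node R i = inverse (1 - (\<Sum>k\<in>nbrs R i. alpha R k i))"

definition Z_edge :: "real mat \<Rightarrow> nat \<Rightarrow> nat \<Rightarrow> real" where
  "Z_edge R i j = inverse (det (mat_of_rows_list 2
      [[1 - alpha_excl R i j, - R $$ (i,j)], [- R $$ (i,j), 1 - alpha_excl R j i]]))"

definition undirected_edges :: "real mat \<Rightarrow> (nat \<times> nat) set" where
  "undirected_edges R = {(i,j). i < j \<and> adj R i j}"

definition Z_bp :: "real mat \<Rightarrow> real" where
  "Z_bp R = (\<Prod>i<dim_row R. Z_node R i) *
     (\<Prod>(i,j)\<in>undirected_edges R. Z_edge R i j / (Z_node R i * Z_node R j))"

definition has_prod_set :: "('a \<Rightarrow> real) \<Rightarrow> real \<Rightarrow> 'a set \<Rightarrow> bool" where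
  "has_prod_set f P A \<longleftrightarrow> ((\<lambda>F. prod f F) \<longlongrightarrow> P) (finite_subsets_at_top A)"

end

theory Submission
  imports Defs
begin

text \<open>
  A closed walk is totally backtracking iff its lift to the universal cover of \<open>G\<close> is closed.
  A vertex of the universal cover is a reduced walk, stored as a stack with the current vertex on
  top, and a step of a walk either pops the stack or pushes a vertex. Decomposing lifted walks by
  their first passages shows that the message \<open>\<alpha>\<^sub>k\<^sub>i\<close> is the weight of the excursions from \<open>i\<close> through
  the neighbour \<open>k\<close>, and that \<open>(1 - \<Sum>\<^sub>k \<alpha>\<^sub>k\<^sub>i)\<^sup>-\<^sup>1\<close> is the weight of all totally backtracking walks
  at \<open>i\<close>.

  Replace \<open>R\<close> by \<open>t R\<close>. As \<open>Z\<^sup>b\<^sup>p\<close> is stationary in the messages, \<open>t d/dt ln Z\<^sup>b\<^sup>p\<close> only receives the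
  explicit contribution of \<open>t\<close>, which is the weight of all nonempty totally backtracking closed walks.
  Hence \<open>ln Z\<^sup>b\<^sup>p\<close> is the sum of weight over length of these walks. Each of them is a unique power of
  a primitive one, which is again totally backtracking because fundamental groups of graphs are
  torsion-free, and a primitive orbit has as many elements as its length. So the sum over the powers
  and rotations of an orbit \<open>\<ell>\<close> is \<open>- ln (1 - R\<^sup>\<ell>)\<close>.
\<close>

section \<open>Lifting walks to the universal cover\<close>

fun push :: "nat list \<Rightarrow> nat \<Rightarrow> nat list" where
  "push (u # w # s) v = (if w = v then w # s else v # u # w # s)"
| "push s v = v # s"

fun reduced :: "nat list \<Rightarrow> bool" where
  "reduced (u # v # w # s) \<longleftrightarrow> u \<noteq> w \<and> reduced (v # w # s)"
| "reduced _ \<longleftrightarrow> True"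

definition lifts :: "nat \<Rightarrow> nat list set" where
  "lifts u = {s. s \<noteq> [] \<and> hd s = u \<and> reduced s}"

definition null_walk :: "nat \<Rightarrow> nat list \<Rightarrow> bool" where
  "null_walk u xs \<longleftrightarrow> (\<forall>s\<in>lifts u. foldl push s xs = s)"

lemma hd_push [simp]: "hd (push s v) = v"
  by (induction s v rule: push.induct) auto

lemma push_neq_Nil [simp]: "push s v \<noteq> []"
  by (induction s v rule: push.induct) auto

lemma reduced_Cons: "reduced (u # s) \<Longrightarrow> reduced s"
  by (induction s rule: reduced.induct) auto

lemma push_lifts: "s \<in> lifts u \<Longrightarrow> push s v \<in> lifts v"
  unfolding lifts_def
  by (induction s v rule: push.induct) (auto dest: reduced_Cons)

text \<open>If the step to \<open>v\<close> pushes, stepping back pops. If it pops, reducedness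
  makes the entry below the new top differ from \<open>u\<close>, so stepping back pushes
  \<open>u\<close> again.\<close>

lemma push_push: "s \<in> lifts u \<Longrightarrow> push (push s v) u = s"
proof -
  assume "s \<in> lifts u"
  then obtain t where s: "s = u # t" and r: "reduced (u # t)"
    by (cases s) (auto simp: lifts_def)
  show ?thesis
  proof (cases t)
    case (Cons w t')
    with r show ?thesis unfolding s by (cases t') auto
  qed (auto simp: s)
qed

lemma push_inj: "s \<in> lifts u \<Longrightarrow> t \<in> lifts u \<Longrightarrow> push s v = push t v \<Longrightarrow> s = t"
  by (metis push_push)

lemma singleton_lifts [simp]: "[u] \<in> lifts u"
  by (simp add: lifts_def)

fun chain :: "nat \<Rightarrow> (nat \<times> nat) list \<Rightarrow> nat \<Rightarrow> bool" where
  "chain u [] v \<longleftrightarrow> u = v"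
| "chain u (e # s) v \<longleftrightarrow> fst e = u \<and> chain (snd e) s v"

lemma chain_append: "chain u (s @ t) v \<longleftrightarrow> (\<exists>w. chain u s w \<and> chain w t v)"
  by (induction s arbitrary: u) auto

definition act :: "(nat \<times> nat) list \<Rightarrow> nat list \<Rightarrow> nat list" where
  "act s \<sigma> = foldl push \<sigma> (map snd s)"

lemma act_Nil [simp]: "act [] \<sigma> = \<sigma>"
  and act_Cons [simp]: "act (e # s) \<sigma> = act s (push \<sigma> (snd e))"
  and act_append [simp]: "act (s @ t) \<sigma> = act t (act s \<sigma>)"
  by (auto simp: act_def)

lemma act_lifts: "chain u s v \<Longrightarrow> \<sigma> \<in> lifts u \<Longrightarrow> act s \<sigma> \<in> lifts v"
  by (induction s arbitrary: u \<sigma>) (auto intro: push_lifts)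

lemma act_inner:
  assumes "chain u (a @ [(i,j), (j,i)] @ b) v" "\<sigma> \<in> lifts u"
  shows "act (a @ [(i,j), (j,i)] @ b) \<sigma> = act (a @ b) \<sigma>"
proof -
  from assms(1) have "chain u a i" by (auto simp: chain_append)
  from act_lifts[OF this assms(2)] show ?thesis by (simp add: push_push)
qed

text \<open>An inner pair cancels by \<open>push_push\<close>. A wrapping pair conjugates by its
  first step and moves the base point from \<open>j\<close> to \<open>i\<close>; hence the
  hypothesis on \<open>t\<close> for all end points.\<close>

lemma bt_del_contracts:
  assumes "bt_del s t" "chain u s v" "\<forall>u v. chain u t v \<longrightarrow> (\<forall>\<sigma>\<in>lifts u. act t \<sigma> = \<sigma>)"
  shows "\<forall>\<sigma>\<in>lifts u. act s \<sigma> = \<sigma>"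
  using assms(1)
proof cases
  case (inner a i j b)
  have "chain u t v" using assms(2) inner by (auto simp: chain_append)
  with assms(3) act_inner[of u a i j b v] assms(2) inner show ?thesis by auto
next
  case (wrap j i)
  with assms(2) have c: "chain i t i" "u = j" by (auto simp: chain_append)
  show ?thesis
  proof
    fix \<sigma> assume s: "\<sigma> \<in> lifts u"
    have "act t (push \<sigma> i) = push \<sigma> i"
      using assms(3) c(1) push_lifts[OF s, of i] by blast
    then show "act s \<sigma> = \<sigma>"
      using wrap c s by (simp add: push_push)
  qed
qed

lemma bt_del_star_contracts:
  assumes "bt_del\<^sup>*\<^sup>* s []"
  shows "\<forall>u v. chain u s v \<longrightarrow> (\<forall>\<sigma>\<in>lifts u. act s \<sigma> = \<sigma>)"
  using assms
proof (induction rule: converse_rtranclp_induct)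
  case (step s t)
  then show ?case using bt_del_contracts by blast
qed simp

lemma steps_Cons: "steps (u # v # xs) = (u, v) # steps (v # xs)"
  by (simp add: steps_def)

lemma steps_single [simp]: "steps [u] = []"
  by (simp add: steps_def)

lemma steps_append: "xs \<noteq> [] \<Longrightarrow> steps (xs @ v # ys) = steps xs @ steps (last xs # v # ys)"
proof (induction xs)
  case (Cons x xs)
  then show ?case by (cases xs) (auto simp: steps_Cons)
qed simp

lemma map_snd_steps [simp]: "map snd (steps (u # xs)) = xs"
  by (induction xs arbitrary: u) (auto simp: steps_Cons)

lemma chain_steps: "chain u (steps (u # xs)) (last (u # xs))"
  by (induction xs arbitrary: u) (auto simp: steps_Cons)

lemma chain_eq_steps: "chain u s v \<Longrightarrow> s = steps (u # map snd s)"
  by (induction s arbitrary: u) (auto simp: steps_Cons prod_eq_iff)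

lemma act_steps: "act (steps (u # xs)) \<sigma> = foldl push \<sigma> xs"
  by (simp add: act_def)

lemma bt_del_append: "bt_del\<^sup>*\<^sup>* (a @ [(i,j),(j,i)] @ b) (a @ b)"
  by (intro r_into_rtranclp bt_del.inner)

text \<open>The path stored in the stack is followed by the steps still to come. A push moves a step
  across this boundary without changing the list; a pop deletes the pair meeting there.\<close>

lemma bt_del_star_to_stack:
  "\<sigma> \<noteq> [] \<Longrightarrow> bt_del\<^sup>*\<^sup>* (steps (rev \<sigma>) @ steps (hd \<sigma> # xs)) (steps (rev (foldl push \<sigma> xs)))"
proof (induction xs arbitrary: \<sigma>)
  case (Cons v xs)
  have IH: "bt_del\<^sup>*\<^sup>* (steps (rev (push \<sigma> v)) @ steps (v # xs)) (steps (rev (foldl push \<sigma> (v # xs))))"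
    using Cons.IH[of "push \<sigma> v"] by simp
  obtain u t where s: "\<sigma> = u # t" using Cons.prems by (cases \<sigma>) auto
  have "bt_del\<^sup>*\<^sup>* (steps (rev \<sigma>) @ steps (hd \<sigma> # v # xs)) (steps (rev (push \<sigma> v)) @ steps (v # xs))"
  proof (cases "\<exists>t'. t = v # t'")
    case True
    then obtain t' where t: "t = v # t'" by blast
    have "steps (rev \<sigma>) = steps (rev t' @ [v]) @ [(v,u)]"
      using steps_append[of "rev t' @ [v]" u "[]"] by (simp add: s t steps_Cons)
    then show ?thesis
      using bt_del_append[of "steps (rev t' @ [v])" v u "steps (v # xs)"]
      by (simp add: s t steps_Cons)
  next
    case False
    then have p: "push \<sigma> v = v # u # t" by (cases t) (auto simp: s)
    have "steps (rev (v # u # t)) = steps (rev (u # t)) @ [(u, v)]"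
      using steps_append[of "rev (u # t)" v "[]"] by (simp add: steps_Cons)
    then show ?thesis unfolding p by (simp add: s steps_Cons)
  qed
  then show ?case using IH by (auto intro: rtranclp_trans)
qed simp

text \<open>The three conditions imply each other in a cycle, so the single stack \<open>[u]\<close>
  decides contractibility.\<close>

lemma null_walk_iff_bt_del: "null_walk u xs \<longleftrightarrow> bt_del\<^sup>*\<^sup>* (steps (u # xs)) []"
  and null_walk_iff_foldl: "null_walk u xs \<longleftrightarrow> foldl push [u] xs = [u]"
proof -
  have 1: "foldl push [u] xs = [u]" if "null_walk u xs"
    using that by (simp add: null_walk_def)
  have 2: "bt_del\<^sup>*\<^sup>* (steps (u # xs)) []" if "foldl push [u] xs = [u]"
    using bt_del_star_to_stack[of "[u]" xs] that by simp
  have 3: "null_walk u xs" if "bt_del\<^sup>*\<^sup>* (steps (u # xs)) []"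
    using bt_del_star_contracts[OF that] chain_steps[of u xs]
    by (auto simp: null_walk_def act_steps)
  show "null_walk u xs \<longleftrightarrow> bt_del\<^sup>*\<^sup>* (steps (u # xs)) []"
    "null_walk u xs \<longleftrightarrow> foldl push [u] xs = [u]"
    using 1 2 3 by blast+
qed

section \<open>Torsion-freeness of fundamental groups of graphs\<close>

lemma nth_concat_replicate:
  "k < m * length s \<Longrightarrow> concat (replicate m s) ! k = s ! (k mod length s)"
proof (induction m arbitrary: k)
  case (Suc m)
  show ?case
  proof (cases "k < length s")
    case False
    then have "concat (replicate (Suc m) s) ! k = concat (replicate m s) ! (k - length s)"
      by (simp add: nth_append)
    also have "\<dots> = s ! ((k - length s) mod length s)"
      using Suc.prems False by (intro Suc.IH) auto
    finally show ?thesis using False by (simp add: le_mod_geq)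
  qed (simp add: nth_append)
qed simp

lemma length_concat_replicate: "length (concat (replicate m s)) = m * length s"
  by (induction m) auto

lemma bt_del_imp_cyclic_pair:
  assumes "bt_del s t"
  shows "\<exists>k<length s. s ! (Suc k mod length s) = prod.swap (s ! k)"
  using assms
proof cases
  case (inner a i j b)
  then show ?thesis by (intro exI[of _ "length a"]) (auto simp: nth_append)
next
  case (wrap j i)
  then show ?thesis by (intro exI[of _ "Suc (length t)"]) (auto simp: nth_append)
qed

text \<open>A cyclic pair is inner unless it straddles the end of the list. Absence of loops rules
  out a list of length one, whose only step would be its own reverse.\<close>

lemma cyclic_pair_imp_bt_del:
  assumes "k < length s" "s ! (Suc k mod length s) = prod.swap (s ! k)" "\<forall>e\<in>set s. fst e \<noteq> snd e"
  shows "\<exists>t. bt_del s t"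
proof (cases "Suc k < length s")
  case True
  obtain i j where e: "s ! k = (i,j)" by fastforce
  have "s ! Suc k = (j,i)" using assms(2) True e by simp
  then have "s = take k s @ [(i,j),(j,i)] @ drop (Suc (Suc k)) s"
    using e True assms(1) by (metis Cons_eq_appendI Cons_nth_drop_Suc append_Nil append_take_drop_id)
  then show ?thesis by (metis bt_del.inner)
next
  case False
  then have k: "length s = Suc k" using assms(1) by simp
  obtain i j where e: "s ! k = (i,j)" by fastforce
  have 0: "s ! 0 = (j,i)" using assms(2) k e by simp
  have "(i,j) \<in> set s" using e assms(1) by (metis nth_mem)
  then have "i \<noteq> j" using assms(3) by force
  then have "k \<noteq> 0" using e 0 by (metis prod.inject)
  obtain x s' where s: "s = x # s'" using k by (cases s) auto
  have "s' \<noteq> []" using k \<open>k \<noteq> 0\<close> s by auto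
  then obtain y s'' where s': "s' = s'' @ [y]" by (metis rev_exhaust)
  have "x = (j,i)" "y = (i,j)" using 0 e k by (auto simp: s s' nth_append)
  then have "s = [(j,i)] @ s'' @ [(i,j)]" by (simp add: s s')
  then show ?thesis by (metis bt_del.wrap)
qed

lemma act_power: "act (concat (replicate m s)) \<sigma> = (act s ^^ m) \<sigma>"
  by (induction m arbitrary: \<sigma>) (auto simp: funpow_swap1)

lemma chain_power: "chain u s u \<Longrightarrow> chain u (concat (replicate m s)) u"
  by (induction m) (auto simp: chain_append)

lemma funpow_lifts: "chain u s u \<Longrightarrow> \<sigma> \<in> lifts u \<Longrightarrow> (act s ^^ m) \<sigma> \<in> lifts u"
  using act_lifts[OF chain_power] by (metis act_power)

text \<open>Fundamental groups of graphs are torsion-free: a power of a cyclically irreducible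
  sequence is again irreducible.\<close>

lemma act_torsion_free:
  assumes "chain u s u" "\<forall>e\<in>set s. fst e \<noteq> snd e" "m > 0"
    and "\<forall>\<sigma>\<in>lifts u. (act s ^^ m) \<sigma> = \<sigma>"
  shows "\<forall>\<sigma>\<in>lifts u. act s \<sigma> = \<sigma>"
  using assms
proof (induction "length s" arbitrary: s u rule: less_induct)
  case less
  show ?case
  proof (cases "s = []")
    case False
    let ?p = "concat (replicate m s)"
    let ?xs = "map snd ?p"
    have p: "?p = steps (u # ?xs)"
      using chain_eq_steps chain_power less.prems(1) by blast
    have "null_walk u ?xs"
      using less.prems(4) unfolding null_walk_def act_power[symmetric] act_def by simp
    then have "bt_del\<^sup>*\<^sup>* ?p []" using p null_walk_iff_bt_del by metis
    moreover have "?p \<noteq> []" using False less.prems(3) by auto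
    \<comment> \<open>The nonempty power reduces to \<open>[]\<close>, so it contains a cyclic pair;
      taking positions modulo \<open>length s\<close> turns it into a cyclic pair of
      \<open>s\<close>.\<close>
    ultimately obtain t where "bt_del ?p t" by (metis converse_rtranclpE)
    from bt_del_imp_cyclic_pair[OF this] obtain k where
      k: "k < m * length s" "?p ! (Suc k mod (m * length s)) = prod.swap (?p ! k)"
      by (auto simp: length_concat_replicate)
    have 1: "Suc k mod (m * length s) < m * length s" using False less.prems(3) by simp
    have "s ! (Suc k mod length s) = prod.swap (s ! (k mod length s))"
      using k(2) nth_concat_replicate[OF 1] nth_concat_replicate[OF k(1)]
      by (simp add: mod_mod_cancel)
    then have "s ! (Suc (k mod length s) mod length s) = prod.swap (s ! (k mod length s))"
      by (simp add: mod_Suc_eq)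
    with cyclic_pair_imp_bt_del[of "k mod length s" s] False less.prems(2)
    obtain t where "bt_del s t" by auto
    then show ?thesis
    proof cases
      case (inner a i j b)
      have eq: "act s \<sigma> = act t \<sigma>" if "\<sigma> \<in> lifts u" for \<sigma>
        using act_inner[of u a i j b u] less.prems(1) inner that by simp
      have "(act t ^^ l) \<sigma> = (act s ^^ l) \<sigma>" if "\<sigma> \<in> lifts u" for \<sigma> l
        by (induction l) (use that eq funpow_lifts[OF less.prems(1)] in auto)
      moreover have "chain u t u" using less.prems(1) inner by (auto simp: chain_append)
      ultimately have "\<forall>\<sigma>\<in>lifts u. act t \<sigma> = \<sigma>"
        using less.prems inner by (intro less.hyps) auto
      then show ?thesis using eq by simp
    next
      case (wrap j i)
      then have uj: "u = j" and t: "chain i t i" using less.prems(1) by (auto simp: chain_append)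
      have act: "act s \<sigma> = push (act t (push \<sigma> i)) j" for \<sigma> using wrap by simp
      \<comment> \<open>Conjugation by the step between \<open>j\<close> and \<open>i\<close>
        relates all powers of the two actions, so the hypothesis on the \<open>m\<close>-th power
        passes to \<open>t\<close>.\<close>
      have pw: "(act s ^^ l) \<sigma> = push ((act t ^^ l) (push \<sigma> i)) j" if "\<sigma> \<in> lifts j" for \<sigma> l
      proof (induction l)
        case 0
        then show ?case using that by (simp add: push_push)
      next
        case (Suc l)
        have "(act t ^^ l) (push \<sigma> i) \<in> lifts i"
          by (intro funpow_lifts t push_lifts[OF that])
        moreover have "(act s ^^ Suc l) \<sigma> = act s (push ((act t ^^ l) (push \<sigma> i)) j)"
          by (simp only: funpow.simps o_apply Suc)
        ultimately show ?case unfolding act[of "push _ _"] by (simp add: push_push)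
      qed
      have "\<forall>\<tau>\<in>lifts i. act t \<tau> = \<tau>"
      proof (rule less.hyps)
        show "\<forall>\<tau>\<in>lifts i. (act t ^^ m) \<tau> = \<tau>"
        proof
          fix \<tau> assume \<tau>: "\<tau> \<in> lifts i"
          have l: "push \<tau> j \<in> lifts j" using \<tau> push_lifts by blast
          have "push ((act t ^^ m) \<tau>) j = push \<tau> j"
            using pw[OF l, of m] less.prems(4) l uj \<tau> by (simp add: push_push)
          then show "(act t ^^ m) \<tau> = \<tau>"
            using push_inj[of _ i] funpow_lifts[OF t \<tau>] \<tau> by blast
        qed
      qed (use wrap t less.prems in auto)
      then show ?thesis using uj by (auto simp: act push_push push_lifts)
    qed
  qed simp
qed

section \<open>Generating functions of contractible walks\<close>

fun walk_from :: "real mat \<Rightarrow> nat \<Rightarrow> nat list \<Rightarrow> bool" where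
  "walk_from R u [] \<longleftrightarrow> True"
| "walk_from R u (v # xs) \<longleftrightarrow> adj R u v \<and> walk_from R v xs"

fun weight :: "real mat \<Rightarrow> nat \<Rightarrow> nat list \<Rightarrow> real" where
  "weight R u [] = 1"
| "weight R u (v # xs) = R $$ (u, v) * weight R v xs"

text \<open>Total weight of the walks of length \<open>L\<close> that turn the stack
  \<open>s\<close> into \<open>[i]\<close>, see \<open>return_weight_eq_sum\<close>; for
  \<open>s = [i]\<close> these are the contractible walks at \<open>i\<close>.\<close>

fun return_weight :: "real mat \<Rightarrow> nat \<Rightarrow> nat \<Rightarrow> nat list \<Rightarrow> real" where
  "return_weight R i 0 s = (if s = [i] then 1 else 0)"
| "return_weight R i (Suc L) s =
     (\<Sum>v\<in>nbrs R (hd s). R $$ (hd s, v) * return_weight R i L (push s v))"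

text \<open>Lets the termination proof of \<open>passage\<close> use that the summation index is at
  most \<open>L\<close>.\<close>

declare sum.cong [fundef_cong]

text \<open>Weight of the walks of given length that lead from a vertex \<open>u\<close> of the universal cover
  to its parent \<open>v\<close> and reach the parent only in their last step: either the first step already
  does, or it leads to a child \<open>k\<close>, from which one first has to come back to \<open>u\<close>.\<close>

function passage :: "real mat \<Rightarrow> nat \<Rightarrow> nat \<Rightarrow> nat \<Rightarrow> real" where
  "passage R 0 u v = 0"
| "passage R (Suc L) u v = (if L = 0 then R $$ (u, v) else 0) +
     (\<Sum>k\<in>nbrs R u - {v}. R $$ (u, k) * (\<Sum>m\<in>{0..L}. passage R m k u * passage R (L - m) u v))"
  by pat_completeness auto
termination by (relation "Wellfounded.measure (\<lambda>(R, L, u, v). L)") auto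

definition passage_series :: "real mat \<Rightarrow> nat \<Rightarrow> nat \<Rightarrow> real fps" where
  "passage_series R u v = Abs_fps (\<lambda>L. passage R L u v)"

definition return_series :: "real mat \<Rightarrow> nat \<Rightarrow> nat list \<Rightarrow> real fps" where
  "return_series R i s = Abs_fps (\<lambda>L. return_weight R i L s)"

text \<open>Excursions from \<open>v\<close> that step to \<open>u\<close> and end on the first
  return. The factor in front is the outward step, its weight \<open>R $$ (v, u)\<close> being
  written with exchanged indices by symmetry.\<close>

definition message_series :: "real mat \<Rightarrow> nat \<Rightarrow> nat \<Rightarrow> real fps" where
  "message_series R u v = fps_const (R $$ (u, v)) * fps_X * passage_series R u v"

lemma finite_nbrs [simp]: "finite (nbrs R i)"
  by (rule finite_subset[of _ "{..<dim_row R}"]) (auto simp: nbrs_def adj_def)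

lemma passage_series_eq:
  "passage_series R u v = fps_X * (fps_const (R $$ (u, v)) +
     (\<Sum>k\<in>nbrs R u - {v}. fps_const (R $$ (u, k)) * (passage_series R k u * passage_series R u v)))"
proof (rule fps_ext)
  fix L
  show "fps_nth (passage_series R u v) L = fps_nth (fps_X * (fps_const (R $$ (u, v)) +
     (\<Sum>k\<in>nbrs R u - {v}. fps_const (R $$ (u, k)) * (passage_series R k u * passage_series R u v)))) L"
  proof (cases L)
    case (Suc L')
    have "fps_nth (passage_series R u v) (Suc L') = (if L' = 0 then R $$ (u, v) else 0) +
     (\<Sum>k\<in>nbrs R u - {v}. R $$ (u, k) * fps_nth (passage_series R k u * passage_series R u v) L')"
      by (simp add: passage_series_def fps_mult_nth)
    then show ?thesis using Suc by (simp add: fps_sum_nth)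
  qed (simp add: passage_series_def)
qed

locale symmetric_weights =
  fixes R :: "real mat" and n :: nat
  assumes carrier: "R \<in> carrier_mat n n"
    and transp: "R\<^sup>T = R"
    and diag: "\<forall>i<n. R $$ (i,i) = 0"
begin

lemma dim_row [simp]: "dim_row R = n" and dim_col [simp]: "dim_col R = n"
  using carrier by auto

lemma sym: "i < n \<Longrightarrow> j < n \<Longrightarrow> R $$ (i, j) = R $$ (j, i)"
  by (metis transp index_transpose_mat(1) dim_row dim_col)

lemma adj_sym: "adj R i j \<Longrightarrow> adj R j i"
  by (auto simp: adj_def sym)

lemma adjD: "adj R i j \<Longrightarrow> i < n" "adj R i j \<Longrightarrow> j < n" "adj R i j \<Longrightarrow> i \<noteq> j"
  "adj R i j \<Longrightarrow> R $$ (i, j) \<noteq> 0" "adj R i j \<Longrightarrow> R $$ (j, i) = R $$ (i, j)"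
  using diag by (auto simp: adj_def sym)

lemma nbrs_iff: "k \<in> nbrs R i \<longleftrightarrow> adj R i k"
  by (simp add: nbrs_def)

lemma nbrs_adj: "k \<in> nbrs R i \<Longrightarrow> adj R k i"
  by (simp add: nbrs_iff adj_sym)

section \<open>First-passage decompositions and the fixed-point equation\<close>

lemma return_weight_step:
  assumes "adj R u v"
  shows "return_weight R i (Suc L) (u # v # s) = R $$ (u, v) * return_weight R i L (v # s) +
    (\<Sum>k\<in>nbrs R u - {v}. R $$ (u, k) * return_weight R i L (k # u # v # s))"
proof -
  have "v \<in> nbrs R u" using assms by (simp add: nbrs_iff)
  then show ?thesis by (simp add: sum.remove)
qed

text \<open>To reach the one-element stack \<open>[i]\<close>, the top \<open>u\<close> must be
  removed at some time. Up to the first such time the walk does not depend on \<open>s\<close>, so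
  it is a passage from \<open>u\<close> to \<open>v\<close>.\<close>

lemma return_weight_passage:
  "adj R u v \<Longrightarrow> return_weight R i L (u # v # s) = fps_nth (passage_series R u v * return_series R i (v # s)) L"
proof (induction L arbitrary: u v s rule: less_induct)
  case (less L)
  show ?case
  proof (cases L)
    case 0
    then show ?thesis by (simp add: passage_series_def)
  next
    case (Suc L')
    \<comment> \<open>After a push of \<open>k\<close> the induction hypothesis is used twice: to
      come back from \<open>k\<close> to \<open>u\<close> and then, at the remaining lengths, to get
      from \<open>u\<close> to \<open>v\<close>.\<close>
    have *: "return_weight R i L' (k # u # v # s) = fps_nth (passage_series R k u * (passage_series R u v * return_series R i (v # s))) L'"
      if k: "k \<in> nbrs R u - {v}" for k
    proof -
      have "return_weight R i L' (k # u # v # s) = fps_nth (passage_series R k u * return_series R i (u # v # s)) L'"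
        using k adj_sym by (intro less.IH) (auto simp: Suc nbrs_iff)
      also have "\<dots> = (\<Sum>m=0..L'. fps_nth (passage_series R k u) m * return_weight R i (L' - m) (u # v # s))"
        by (simp add: fps_mult_nth return_series_def)
      also have "\<dots> = (\<Sum>m=0..L'. fps_nth (passage_series R k u) m * fps_nth (passage_series R u v * return_series R i (v # s)) (L' - m))"
        using less.prems by (intro sum.cong refl arg_cong2[of _ _ _ _ "(*)"] less.IH) (auto simp: Suc)
      also have "\<dots> = fps_nth (passage_series R k u * (passage_series R u v * return_series R i (v # s))) L'"
        by (simp add: fps_mult_nth)
      finally show ?thesis .
    qed
    have "return_weight R i L (u # v # s) = R $$ (u, v) * fps_nth (return_series R i (v # s)) L' +
       (\<Sum>k\<in>nbrs R u - {v}. R $$ (u, k) * fps_nth (passage_series R k u * (passage_series R u v * return_series R i (v # s))) L')"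
      using return_weight_step[OF less.prems] * by (simp add: Suc return_series_def)
    also have "\<dots> = fps_nth (fps_X * (fps_const (R $$ (u, v)) +
       (\<Sum>k\<in>nbrs R u - {v}. fps_const (R $$ (u, k)) * (passage_series R k u * passage_series R u v))) * return_series R i (v # s)) L"
      by (simp add: Suc mult.assoc distrib_right sum_distrib_right fps_sum_nth)
    also have "\<dots> = fps_nth (passage_series R u v * return_series R i (v # s)) L"
      by (simp only: passage_series_eq[symmetric])
    finally show ?thesis .
  qed
qed

text \<open>Renewal equation: a contractible walk is empty or starts with an excursion through one
  neighbour, after which the stack is \<open>[i]\<close> again.\<close>

lemma return_series_eq: "return_series R i [i] = 1 + (\<Sum>k\<in>nbrs R i. message_series R k i) * return_series R i [i]"
proof (rule fps_ext)
  fix L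
  show "fps_nth (return_series R i [i]) L = fps_nth (1 + (\<Sum>k\<in>nbrs R i. message_series R k i) * return_series R i [i]) L"
  proof (cases L)
    case 0
    have "fps_nth (\<Sum>k\<in>nbrs R i. message_series R k i) 0 = 0"
      by (simp add: fps_sum_nth message_series_def passage_series_def)
    then show ?thesis by (simp add: 0 return_series_def)
  next
    case (Suc L')
    have "fps_nth (return_series R i [i]) L = (\<Sum>k\<in>nbrs R i. R $$ (i, k) * fps_nth (passage_series R k i * return_series R i [i]) L')"
      using return_weight_passage[where v = i and s = "[]"] adj_sym
      by (simp add: Suc return_series_def nbrs_iff)
    also have "\<dots> = (\<Sum>k\<in>nbrs R i. fps_nth (message_series R k i * return_series R i [i]) L)"
      by (intro sum.cong) (auto simp: Suc message_series_def mult.assoc nbrs_iff dest: adjD(5))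
    finally show ?thesis by (simp add: Suc sum_distrib_right fps_sum_nth)
  qed
qed

text \<open>The belief propagation fixed-point equation with the denominator cleared, where
  \<open>fps_X\<close> marks the length.\<close>

lemma message_series_eq:
  assumes "adj R u v"
  shows "message_series R u v = fps_const ((R $$ (u, v))\<^sup>2) * fps_X\<^sup>2 +
    message_series R u v * (\<Sum>k\<in>nbrs R u - {v}. message_series R k u)"
proof -
  have m: "message_series R k u = fps_const (R $$ (u, k)) * fps_X * passage_series R k u" if "k \<in> nbrs R u" for k
    using that by (auto simp: message_series_def nbrs_iff dest: adjD(5))
  have "message_series R u v = fps_const (R $$ (u, v)) * fps_X * (fps_X * (fps_const (R $$ (u, v)) +
     (\<Sum>k\<in>nbrs R u - {v}. fps_const (R $$ (u, k)) * (passage_series R k u * passage_series R u v))))"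
    unfolding message_series_def using passage_series_eq[of R u v] by simp
  also have "\<dots> = fps_const (R $$ (u, v) * R $$ (u, v)) * fps_X\<^sup>2 +
    (\<Sum>k\<in>nbrs R u - {v}. message_series R u v * message_series R k u)"
    by (simp add: m message_series_def[of R u v] algebra_simps sum_distrib_left power2_eq_square
        flip: fps_const_mult)
  finally show ?thesis by (simp add: sum_distrib_left power2_eq_square)
qed

lemma message_series_0: "fps_nth (message_series R u v) 0 = 0"
  by (simp add: message_series_def passage_series_def)

lemma message_series_nth:
  assumes "adj R u v"
  shows "fps_nth (message_series R u v) L = (if L = 2 then (R $$ (u, v))\<^sup>2 else 0) +
    (\<Sum>m=0..L. fps_nth (message_series R u v) m * (\<Sum>k\<in>nbrs R u - {v}. fps_nth (message_series R k u) (L - m)))"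
proof -
  have "fps_nth (fps_const c * fps_X\<^sup>2) L = (if L = 2 then c else (0::real))" for c
    by (simp only: fps_mult_left_const_nth) simp
  then show ?thesis
    by (subst message_series_eq[OF assms]) (simp add: fps_mult_nth[of "message_series R u v"] fps_sum_nth)
qed

text \<open>Only squares of entries enter the fixed-point equation, so the signs of \<open>R\<close>
  disappear. Both factors of the convolution have constant coefficient 0, hence only degrees below
  \<open>L\<close> contribute.\<close>

lemma message_series_nonneg: "adj R u v \<Longrightarrow> fps_nth (message_series R u v) L \<ge> 0"
proof (induction L arbitrary: u v rule: less_induct)
  case (less L)
  have "fps_nth (message_series R u v) m * (\<Sum>k\<in>nbrs R u - {v}. fps_nth (message_series R k u) (L - m)) \<ge> 0"
    if "m \<in> {0..L}" for m
  proof (cases "m = 0 \<or> m = L")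
    case True
    then show ?thesis by (auto simp: message_series_0)
  next
    case False
    with that have "m < L" "L - m < L" by auto
    then show ?thesis
      using less adj_sym by (intro mult_nonneg_nonneg sum_nonneg) (auto simp: nbrs_iff)
  qed
  then show ?case
    by (subst message_series_nth[OF less.prems]) (auto intro!: add_nonneg_nonneg sum_nonneg)
qed

lemma return_series_nth_0: "fps_nth (return_series R i [i]) 0 = 1"
  by (simp add: return_series_def)

lemma return_series_nth:
  "fps_nth (return_series R i [i]) L = (if L = 0 then 1 else 0) +
    (\<Sum>m=0..L. (\<Sum>k\<in>nbrs R i. fps_nth (message_series R k i) m) * fps_nth (return_series R i [i]) (L - m))"
  by (subst return_series_eq) (simp add: fps_mult_nth fps_sum_nth)

lemma return_series_nonneg: "fps_nth (return_series R i [i]) L \<ge> 0"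
proof (induction L rule: less_induct)
  case (less L)
  have "(\<Sum>k\<in>nbrs R i. fps_nth (message_series R k i) m) * fps_nth (return_series R i [i]) (L - m) \<ge> 0"
    if "m \<in> {0..L}" for m
  proof (cases "m = 0")
    case False
    with that have "L - m < L" by auto
    then show ?thesis
      using less adj_sym message_series_nonneg by (intro mult_nonneg_nonneg sum_nonneg) (auto simp: nbrs_iff)
  qed (simp add: message_series_0)
  then show ?case
    by (subst return_series_nth) (auto intro!: add_nonneg_nonneg sum_nonneg)
qed

text \<open>One term of the renewal convolution pairs the message with the empty return walk. This
  transfers convergence from the return series to the messages.\<close>

lemma message_series_le_return_series:
  assumes "adj R k i"
  shows "fps_nth (message_series R k i) L \<le> fps_nth (return_series R i [i]) L"
proof -
  have s: "(\<Sum>k\<in>nbrs R i. fps_nth (message_series R k i) m) \<ge> 0" for m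
    using adj_sym message_series_nonneg by (intro sum_nonneg) (auto simp: nbrs_iff)
  have "fps_nth (message_series R k i) L \<le> (\<Sum>k\<in>nbrs R i. fps_nth (message_series R k i) L)"
    using assms adj_sym message_series_nonneg by (intro member_le_sum) (auto simp: nbrs_iff)
  also have "\<dots> = (\<Sum>k\<in>nbrs R i. fps_nth (message_series R k i) L) * fps_nth (return_series R i [i]) (L - L)"
    by (simp add: return_series_nth_0)
  also have "\<dots> \<le> (\<Sum>m=0..L. (\<Sum>k\<in>nbrs R i. fps_nth (message_series R k i) m) * fps_nth (return_series R i [i]) (L - m))"
    using s return_series_nonneg
    by (intro member_le_sum[of L "{0..L}" "\<lambda>m. (\<Sum>k\<in>nbrs R i. fps_nth (message_series R k i) m) * fps_nth (return_series R i [i]) (L - m)"]) auto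
  also have "\<dots> \<le> fps_nth (return_series R i [i]) L"
    by (subst (2) return_series_nth) simp
  finally show ?thesis .
qed

lemma hd_foldl_push: "xs \<noteq> [] \<Longrightarrow> hd (foldl push s xs) = last xs"
  by (induction xs rule: rev_induct) auto

lemma walk_from_subset: "walk_from R u xs \<Longrightarrow> set xs \<subseteq> {..<n}"
  by (induction xs arbitrary: u) (auto simp: adjD)

definition returns :: "nat \<Rightarrow> nat \<Rightarrow> nat list \<Rightarrow> nat list set" where
  "returns i L s = {xs. length xs = L \<and> walk_from R (hd s) xs \<and> foldl push s xs = [i]}"

lemma finite_returns: "finite (returns i L s)"
  by (rule finite_subset[OF _ finite_lists_length_eq[of "{..<n}" L]])
     (auto simp: returns_def dest: walk_from_subset)

lemma return_weight_eq_sum: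
  "return_weight R i L s = (\<Sum>xs\<in>returns i L s. weight R (hd s) xs)"
proof (induction L arbitrary: s)
  case 0
  have "returns i 0 s = (if s = [i] then {[]} else {})" by (auto simp: returns_def)
  then show ?case by simp
next
  case (Suc L)
  have eq: "returns i (Suc L) s = (\<Union>v\<in>nbrs R (hd s). (#) v ` returns i L (push s v))"
    by (auto simp: returns_def nbrs_iff length_Suc_conv)
  have "(\<Sum>xs\<in>returns i (Suc L) s. weight R (hd s) xs) =
    (\<Sum>v\<in>nbrs R (hd s). \<Sum>xs\<in>(#) v ` returns i L (push s v). weight R (hd s) xs)"
    unfolding eq by (rule sum.UNION_disjoint) (auto simp: finite_returns)
  also have "\<dots> = (\<Sum>v\<in>nbrs R (hd s). R $$ (hd s, v) * (\<Sum>xs\<in>returns i L (push s v). weight R v xs))"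
    by (intro sum.cong refl) (simp add: sum.reindex sum_distrib_left)
  finally show ?case by (simp add: Suc)
qed

end

section \<open>Convergence\<close>

text \<open>An eigenvector of the scaled matrix for \<open>k\<close> is one of \<open>A\<close> for
  \<open>k / c\<close>. Used with a factor above 1, to turn the strict bound on the spectral radius
  into exponential decay.\<close>

lemma spectral_radius_smult_less_1:
  assumes A: "(A :: complex mat) \<in> carrier_mat n n" and n: "n > 0" and c: "c > 0"
    and less: "spectral_radius A < inverse c"
  shows "spectral_radius (complex_of_real c \<cdot>\<^sub>m A) < 1"
proof -
  let ?c = "complex_of_real c"
  have A': "?c \<cdot>\<^sub>m A \<in> carrier_mat n n" using A by simp
  obtain k where k: "k \<in> spectrum (?c \<cdot>\<^sub>m A)" and sr: "spectral_radius (?c \<cdot>\<^sub>m A) = cmod k"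
    using spectral_radius_mem_max(1)[OF A' n] by auto
  from k obtain v where v: "v \<in> carrier_vec n" "v \<noteq> 0\<^sub>v n" "(?c \<cdot>\<^sub>m A) *\<^sub>v v = k \<cdot>\<^sub>v v"
    using A by (auto simp: spectrum_def eigenvalue_def eigenvector_def)
  have "A *\<^sub>v v = (k / ?c) \<cdot>\<^sub>v v"
  proof (rule eq_vecI)
    fix i assume "i < dim_vec ((k / ?c) \<cdot>\<^sub>v v)"
    then have i: "i < n" using v by simp
    have "((?c \<cdot>\<^sub>m A) *\<^sub>v v) $ i = k * v $ i" using v i by simp
    moreover have "((?c \<cdot>\<^sub>m A) *\<^sub>v v) $ i = ?c * ((A *\<^sub>v v) $ i)"
      using A i v(1) by (simp add: scalar_prod_def sum_distrib_left mult.assoc)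
    ultimately have "?c * ((A *\<^sub>v v) $ i) = k * v $ i" by simp
    then show "(A *\<^sub>v v) $ i = ((k / ?c) \<cdot>\<^sub>v v) $ i"
      using c i v by (simp add: field_simps)
  qed (use A v in auto)
  then have "k / ?c \<in> spectrum A"
    using v A by (auto simp: spectrum_def eigenvalue_def eigenvector_def)
  then have "cmod (k / ?c) \<le> spectral_radius A"
    using spectral_radius_mem_max(2)[OF A n] by blast
  then have "cmod (k / ?c) < inverse c" using less by simp
  then show ?thesis using c by (simp add: sr norm_divide field_simps)
qed

lemma fps_conv_radius_geI_bounded:
  fixes f :: "real fps"
  assumes s: "s > 0" and bd: "\<And>L. \<bar>fps_nth f L\<bar> * s ^ L \<le> C"
  shows "fps_conv_radius f \<ge> ereal s"
  unfolding fps_conv_radius_def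
proof (rule conv_radius_geI_ex')
  fix r :: real assume r: "0 < r" "ereal r < ereal s"
  have "summable (\<lambda>L. C * (r / s) ^ L)"
    using r s by (intro summable_mult summable_geometric) auto
  then show "summable (\<lambda>L. fps_nth f L * of_real r ^ L)"
  proof (rule summable_comparison_test[rotated], intro exI[of _ 0] allI impI)
    fix L :: nat
    have "norm (fps_nth f L * of_real r ^ L) = \<bar>fps_nth f L\<bar> * s ^ L * (r / s) ^ L"
      using r s by (simp add: abs_mult power_divide)
    also have "\<dots> \<le> C * (r / s) ^ L" using bd r s by (intro mult_right_mono) auto
    finally show "norm (fps_nth f L * of_real r ^ L) \<le> C * (r / s) ^ L" .
  qed
qed

text \<open>Column sums of the powers of \<open>c |R|\<close>, see
  \<open>abs_walks_eq_column_sum\<close>.\<close>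

fun abs_walks :: "real mat \<Rightarrow> real \<Rightarrow> nat \<Rightarrow> nat \<Rightarrow> real" where
  "abs_walks R c 0 j = 1"
| "abs_walks R c (Suc L) j = (\<Sum>k<dim_row R. abs_walks R c L k * (c * \<bar>R $$ (k, j)\<bar>))"

lemma abs_walks_nonneg: "c \<ge> 0 \<Longrightarrow> abs_walks R c L j \<ge> 0"
  by (induction L arbitrary: j) (auto intro!: sum_nonneg mult_nonneg_nonneg)

context symmetric_weights begin

lemma abs_walks_eq_column_sum:
  defines "M \<equiv> \<lambda>c. complex_of_real c \<cdot>\<^sub>m map_mat complex_of_real (abs_mat R)"
  shows "j < n \<Longrightarrow> complex_of_real (abs_walks R c L j) = (\<Sum>i<n. (M c ^\<^sub>m L) $$ (i, j))"
proof (induction L arbitrary: j)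
  case 0
  then show ?case by (simp add: M_def abs_mat_def one_mat_def)
next
  case (Suc L)
  have M: "M c \<in> carrier_mat n n" using carrier by (simp add: M_def abs_mat_def)
  have P: "M c ^\<^sub>m L \<in> carrier_mat n n" using M by (rule pow_carrier_mat)
  have "(\<Sum>i<n. (M c ^\<^sub>m Suc L) $$ (i, j)) =
     (\<Sum>i<n. \<Sum>k<n. (M c ^\<^sub>m L) $$ (i, k) * complex_of_real (c * \<bar>R $$ (k, j)\<bar>))"
    using M P Suc.prems
    by (intro sum.cong refl) (simp add: scalar_prod_def M_def abs_mat_def atLeast0LessThan)
  also have "\<dots> = (\<Sum>k<n. (\<Sum>i<n. (M c ^\<^sub>m L) $$ (i, k)) * complex_of_real (c * \<bar>R $$ (k, j)\<bar>))"
    by (subst sum.swap) (simp add: sum_distrib_right)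
  also have "\<dots> = complex_of_real (abs_walks R c (Suc L) j)"
    by (simp add: Suc.IH)
  finally show ?case by simp
qed

text \<open>Forgetting signs and the condition on the final stack leaves a sum over all walks from
  \<open>hd s\<close>.\<close>

lemma return_weight_le_abs_walks:
  assumes c: "c > 0"
  shows "hd s < n \<Longrightarrow> \<bar>return_weight R i L s\<bar> * c ^ L \<le> abs_walks R c L (hd s)"
proof (induction L arbitrary: s)
  case (Suc L)
  have "\<bar>return_weight R i (Suc L) s\<bar> * c ^ Suc L \<le>
     (\<Sum>v\<in>nbrs R (hd s). \<bar>R $$ (hd s, v) * return_weight R i L (push s v)\<bar>) * c ^ Suc L"
    using c by (auto intro!: mult_right_mono)
  also have "\<dots> = (\<Sum>v\<in>nbrs R (hd s). \<bar>return_weight R i L (push s v)\<bar> * c ^ L * (c * \<bar>R $$ (v, hd s)\<bar>))"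
    unfolding sum_distrib_right
    by (intro sum.cong refl) (auto simp: abs_mult nbrs_iff dest: adjD(5))
  also have "\<dots> \<le> (\<Sum>v\<in>nbrs R (hd s). abs_walks R c L v * (c * \<bar>R $$ (v, hd s)\<bar>))"
  proof (intro sum_mono mult_right_mono)
    fix v assume "v \<in> nbrs R (hd s)"
    then have "hd (push s v) < n" by (simp add: nbrs_iff adjD)
    from Suc.IH[OF this] show "\<bar>return_weight R i L (push s v)\<bar> * c ^ L \<le> abs_walks R c L v" by simp
  qed (use c in auto)
  also have "\<dots> \<le> (\<Sum>v<n. abs_walks R c L v * (c * \<bar>R $$ (v, hd s)\<bar>))"
    using c by (intro sum_mono2) (auto simp: nbrs_iff adjD abs_walks_nonneg)
  finally show ?case by simp
qed simp

lemma return_weight_bound: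
  assumes sr: "spectral_radius (map_mat complex_of_real (abs_mat R)) < 1"
  shows "\<exists>c C. c > 1 \<and> (\<forall>i<n. \<forall>L. \<bar>return_weight R i L [i]\<bar> * c ^ L \<le> C)"
proof (cases "n = 0")
  case True
  then show ?thesis by (intro exI[of _ 2]) auto
next
  case False
  let ?A = "map_mat complex_of_real (abs_mat R)"
  have A: "?A \<in> carrier_mat n n" using carrier by (simp add: abs_mat_def)
  \<comment> \<open>The maximum with 0 keeps \<open>d\<close> positive; \<open>inverse d > 1\<close>
    becomes the exponential rate.\<close>
  obtain d where d: "d > 0" "spectral_radius ?A < d" "d < 1"
    using sr dense[of "max 0 (spectral_radius ?A)" 1] by auto
  let ?M = "complex_of_real (inverse d) \<cdot>\<^sub>m ?A"
  have M: "?M \<in> carrier_mat n n" using A by simp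
  have "spectral_radius ?M < 1"
    using d False by (intro spectral_radius_smult_less_1[OF A]) auto
  from spectral_radius_jnf_norm_bound_less_1_upper_triangular[OF M this]
  obtain K where K: "\<And>k. norm_bound (?M ^\<^sub>m k) K" by blast
  have "\<bar>return_weight R i L [i]\<bar> * inverse d ^ L \<le> n * K" if i: "i < n" for i L
  proof -
    have "\<bar>return_weight R i L [i]\<bar> * inverse d ^ L \<le> abs_walks R (inverse d) L i"
      using return_weight_le_abs_walks[of "inverse d" "[i]" i L] d i by simp
    also have "\<dots> \<le> cmod (complex_of_real (abs_walks R (inverse d) L i))" by simp
    also have "\<dots> \<le> (\<Sum>j<n. cmod ((?M ^\<^sub>m L) $$ (j, i)))"
      unfolding abs_walks_eq_column_sum[OF i] by (rule norm_sum)
    also have "\<dots> \<le> (\<Sum>j<n. K)"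
      using K[of L] M i by (intro sum_mono) (auto simp: norm_bound_def abs_mat_def)
    finally show ?thesis by simp
  qed
  moreover have "inverse d > 1" using d by (simp add: one_less_inverse)
  ultimately show ?thesis by blast
qed

lemma sum_undirected_edges:
  fixes g :: "nat \<Rightarrow> nat \<Rightarrow> real"
  shows "(\<Sum>(i,j)\<in>undirected_edges R. g i j + g j i) = (\<Sum>i<n. \<Sum>k\<in>nbrs R i. g k i)"
proof -
  let ?E = "undirected_edges R"
  let ?D = "SIGMA i:{..<n}. nbrs R i"
  have D: "?D = ?E \<union> prod.swap ` ?E"
    by (auto simp: undirected_edges_def nbrs_iff adjD image_iff dest: adj_sym)
       (metis adjD(3) linorder_neqE_nat adj_sym)+
  have fin: "finite ?E"
    by (rule finite_subset[of _ "{..<n} \<times> {..<n}"]) (auto simp: undirected_edges_def adjD)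
  have "(\<Sum>i<n. \<Sum>k\<in>nbrs R i. g k i) = (\<Sum>(i,k)\<in>?D. g k i)"
    by (rule sum.Sigma) auto
  also have "\<dots> = (\<Sum>(i,k)\<in>?E. g k i) + (\<Sum>(i,k)\<in>prod.swap ` ?E. g k i)"
    unfolding D using fin by (intro sum.union_disjoint) (auto simp: undirected_edges_def)
  also have "(\<Sum>(i,k)\<in>prod.swap ` ?E. g k i) = (\<Sum>(i,k)\<in>?E. g i k)"
    by (subst sum.reindex) (auto simp: case_prod_unfold)
  finally show ?thesis by (simp add: sum.distrib case_prod_unfold)
qed

end

section \<open>The derivative of the belief propagation estimate\<close>

text \<open>\<open>c > 1\<close> places the end point \<open>t = 1\<close> in the interior of the
  disc of convergence of every series below.\<close>

locale convergent_weights = symmetric_weights +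
  fixes c C :: real
  assumes c: "c > 1"
    and bound: "\<And>i L. i < n \<Longrightarrow> \<bar>return_weight R i L [i]\<bar> * c ^ L \<le> C"
begin

section \<open>Convergence and evaluation of the generating functions\<close>

lemma conv_return_series: "i < n \<Longrightarrow> fps_conv_radius (return_series R i [i]) \<ge> ereal c"
  using c bound by (intro fps_conv_radius_geI_bounded[of _ _ C]) (auto simp: return_series_def)

text \<open>Up to a shift and the nonzero factor \<open>R $$ (u, v)\<close>, passage coefficients
  are message coefficients, which return coefficients dominate.\<close>

lemma conv_passage: "adj R u v \<Longrightarrow> fps_conv_radius (passage_series R u v) \<ge> ereal c"
proof (rule fps_conv_radius_geI_bounded)
  fix L assume a: "adj R u v"
  have r: "\<bar>R $$ (u, v)\<bar> > 0" using a by (simp add: adjD)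
  have "\<bar>R $$ (u, v)\<bar> * \<bar>fps_nth (passage_series R u v) L\<bar> = \<bar>fps_nth (message_series R u v) (Suc L)\<bar>"
    by (simp add: message_series_def mult.assoc abs_mult)
  also have "\<dots> \<le> \<bar>fps_nth (return_series R v [v]) (Suc L)\<bar>"
    using message_series_le_return_series[OF a, of "Suc L"] message_series_nonneg[OF a, of "Suc L"] by simp
  finally have 1: "\<bar>R $$ (u, v)\<bar> * \<bar>fps_nth (passage_series R u v) L\<bar> * c ^ Suc L \<le> C"
  proof -
    assume "\<bar>R $$ (u, v)\<bar> * \<bar>fps_nth (passage_series R u v) L\<bar> \<le> \<bar>fps_nth (return_series R v [v]) (Suc L)\<bar>"
    then have "\<bar>R $$ (u, v)\<bar> * \<bar>fps_nth (passage_series R u v) L\<bar> * c ^ Suc L \<le> \<bar>fps_nth (return_series R v [v]) (Suc L)\<bar> * c ^ Suc L"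
      using c by (intro mult_right_mono) auto
    then show ?thesis using bound[OF adjD(2)[OF a], of "Suc L"] by (simp add: return_series_def)
  qed
  have "\<bar>R $$ (u, v)\<bar> * \<bar>fps_nth (passage_series R u v) L\<bar> * c ^ L \<le> \<bar>R $$ (u, v)\<bar> * \<bar>fps_nth (passage_series R u v) L\<bar> * c ^ Suc L"
    using c by (intro mult_left_mono) auto
  with 1 have "\<bar>R $$ (u, v)\<bar> * (\<bar>fps_nth (passage_series R u v) L\<bar> * c ^ L) \<le> C"
    by (simp only: mult.assoc)
  then show "\<bar>fps_nth (passage_series R u v) L\<bar> * c ^ L \<le> C / \<bar>R $$ (u, v)\<bar>"
    using r by (simp add: pos_le_divide_eq mult.commute)
qed (use c in simp)

lemma conv_mult: "fps_conv_radius f \<ge> ereal c \<Longrightarrow> fps_conv_radius g \<ge> ereal c \<Longrightarrow>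
    fps_conv_radius (f * g :: real fps) \<ge> ereal c"
  by (rule order_trans[OF _ fps_conv_radius_mult]) simp

lemma conv_add: "fps_conv_radius f \<ge> ereal c \<Longrightarrow> fps_conv_radius g \<ge> ereal c \<Longrightarrow>
    fps_conv_radius (f + g :: real fps) \<ge> ereal c"
  by (rule order_trans[OF _ fps_conv_radius_add]) simp

lemma conv_sum: "(\<And>x. x \<in> A \<Longrightarrow> fps_conv_radius (f x) \<ge> ereal c) \<Longrightarrow>
    fps_conv_radius (sum f A :: real fps) \<ge> ereal c"
  by (induction A rule: infinite_finite_induct) (auto intro: conv_add)

lemma conv_message_series: "adj R u v \<Longrightarrow> fps_conv_radius (message_series R u v) \<ge> ereal c"
  unfolding message_series_def by (intro conv_mult conv_passage) auto

lemma conv_less: "\<bar>t\<bar> < c \<Longrightarrow> fps_conv_radius f \<ge> ereal c \<Longrightarrow> ereal (norm (t::real)) < fps_conv_radius f"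
  by (rule less_le_trans[of _ "ereal c"]) auto

lemma eval_mult: "\<bar>t\<bar> < c \<Longrightarrow> fps_conv_radius f \<ge> ereal c \<Longrightarrow> fps_conv_radius g \<ge> ereal c \<Longrightarrow>
    eval_fps (f * g) t = eval_fps f t * eval_fps g (t::real)"
  by (intro eval_fps_mult conv_less)

lemma eval_add: "\<bar>t\<bar> < c \<Longrightarrow> fps_conv_radius f \<ge> ereal c \<Longrightarrow> fps_conv_radius g \<ge> ereal c \<Longrightarrow>
    eval_fps (f + g) t = eval_fps f t + eval_fps g (t::real)"
  by (intro eval_fps_add conv_less)

lemma eval_sum: "\<bar>t\<bar> < c \<Longrightarrow> (\<And>x. x \<in> A \<Longrightarrow> fps_conv_radius (f x) \<ge> ereal c) \<Longrightarrow>
    eval_fps (sum f A) t = (\<Sum>x\<in>A. eval_fps (f x) (t::real))"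
  by (induction A rule: infinite_finite_induct) (auto simp: eval_add conv_sum)

text \<open>Walks of length \<open>L\<close> acquire the factor \<open>t ^ L\<close>, so evaluation
  at \<open>t\<close> replaces \<open>R\<close> by \<open>t R\<close>. Then \<open>b\<close> is the
  first-passage weight, \<open>\<alpha>\<close> the message, \<open>A\<close> the sum of the
  messages into a vertex and \<open>W\<close> the weight of all contractible walks there.\<close>

definition b :: "nat \<Rightarrow> nat \<Rightarrow> real \<Rightarrow> real" where
  "b u v t = eval_fps (passage_series R u v) t"

definition W :: "nat \<Rightarrow> real \<Rightarrow> real" where
  "W i t = eval_fps (return_series R i [i]) t"

definition \<alpha> :: "nat \<Rightarrow> nat \<Rightarrow> real \<Rightarrow> real" where
  "\<alpha> u v t = R $$ (u, v) * t * b u v t"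

definition A :: "nat \<Rightarrow> real \<Rightarrow> real" where
  "A i t = (\<Sum>k\<in>nbrs R i. \<alpha> k i t)"

lemma eval_message_series: "adj R u v \<Longrightarrow> \<bar>t\<bar> < c \<Longrightarrow> eval_fps (message_series R u v) t = \<alpha> u v t"
  unfolding message_series_def \<alpha>_def b_def by (simp add: eval_mult conv_mult conv_passage)

lemma W_eq: "i < n \<Longrightarrow> \<bar>t\<bar> < c \<Longrightarrow> W i t * (1 - A i t) = 1"
proof -
  assume i: "i < n" and t: "\<bar>t\<bar> < c"
  have cs: "fps_conv_radius (\<Sum>k\<in>nbrs R i. message_series R k i) \<ge> ereal c"
    by (intro conv_sum conv_message_series) (auto simp: nbrs_adj)
  have "W i t = eval_fps (1 + (\<Sum>k\<in>nbrs R i. message_series R k i) * return_series R i [i]) t"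
    unfolding W_def by (subst return_series_eq) simp
  also have "\<dots> = 1 + eval_fps (\<Sum>k\<in>nbrs R i. message_series R k i) t * W i t"
    unfolding W_def using t cs i by (simp add: eval_add eval_mult conv_mult conv_return_series)
  also have "eval_fps (\<Sum>k\<in>nbrs R i. message_series R k i) t = A i t"
    unfolding A_def using t
    by (subst eval_sum) (auto simp: nbrs_adj conv_message_series eval_message_series intro!: sum.cong)
  finally show ?thesis by (simp add: algebra_simps)
qed

lemma A_split: "adj R u v \<Longrightarrow> A u t = \<alpha> v u t + (\<Sum>k\<in>nbrs R u - {v}. \<alpha> k u t)"
  unfolding A_def by (rule sum.remove) (auto simp: nbrs_iff)

lemma \<alpha>_excl_eq: "adj R u v \<Longrightarrow> (\<Sum>k\<in>nbrs R u - {v}. \<alpha> k u t) = A u t - \<alpha> v u t"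
  by (simp add: A_split)

lemma b_eq:
  assumes "adj R u v" "\<bar>t\<bar> < c"
  shows "b u v t = t * R $$ (u, v) + b u v t * (A u t - \<alpha> v u t)"
proof -
  have k: "fps_conv_radius (passage_series R k u) \<ge> ereal c" if "k \<in> nbrs R u - {v}" for k
    using that by (intro conv_passage) (auto simp: nbrs_adj)
  have uv: "fps_conv_radius (passage_series R u v) \<ge> ereal c" using assms by (intro conv_passage)
  let ?S = "\<Sum>k\<in>nbrs R u - {v}. fps_const (R $$ (u, k)) * (passage_series R k u * passage_series R u v)"
  have S: "fps_conv_radius ?S \<ge> ereal c"
    by (intro conv_sum conv_mult k uv) auto
  have E: "eval_fps ?S t = (\<Sum>k\<in>nbrs R u - {v}. R $$ (u, k) * (b k u t * b u v t))"
    unfolding b_def using k uv assms(2)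
    by (subst eval_sum) (auto simp: eval_mult conv_mult intro!: sum.cong conv_mult)
  have "b u v t = eval_fps (fps_X * (fps_const (R $$ (u, v)) +
     (\<Sum>k\<in>nbrs R u - {v}. fps_const (R $$ (u, k)) * (passage_series R k u * passage_series R u v)))) t"
    unfolding b_def by (subst passage_series_eq) simp
  also have "\<dots> = t * (R $$ (u, v) + (\<Sum>k\<in>nbrs R u - {v}. R $$ (u, k) * (b k u t * b u v t)))"
    unfolding E[symmetric] using S assms(2) by (simp add: eval_add eval_mult conv_add)
  also have "\<dots> = t * R $$ (u, v) + b u v t * (\<Sum>k\<in>nbrs R u - {v}. \<alpha> k u t)"
    unfolding sum_distrib_left distrib_left \<alpha>_def
    by (intro arg_cong2[of _ _ _ _ "(+)"] sum.cong refl) (auto simp: nbrs_iff dest: adjD(5))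
  finally show ?thesis using \<alpha>_excl_eq[OF assms(1)] by simp
qed

lemma \<alpha>_eq:
  assumes "adj R u v" "\<bar>t\<bar> < c"
  shows "\<alpha> u v t * (1 - A u t + \<alpha> v u t) = (R $$ (u, v) * t)\<^sup>2"
proof -
  have "b u v t * (1 - A u t + \<alpha> v u t) = t * R $$ (u, v)"
    using b_eq[OF assms] by (simp add: algebra_simps)
  then have "R $$ (u, v) * t * (b u v t * (1 - A u t + \<alpha> v u t)) = R $$ (u, v) * t * (t * R $$ (u, v))"
    by simp
  then show ?thesis by (simp add: \<alpha>_def power2_eq_square mult_ac)
qed

text \<open>This identity makes the belief propagation estimate stationary with respect to the messages.\<close>

lemma b_mult_A:
  assumes "adj R u v" "\<bar>t\<bar> < c"
  shows "b u v t * (1 - A u t) = t * R $$ (u, v) * (1 - b u v t * b v u t)"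
  using b_eq[OF assms] adjD(5)[OF assms(1)] by (simp add: \<alpha>_def algebra_simps)

section \<open>Positivity for \<open>0 \<le> t < c\<close>\<close>

lemma eval_nonneg_ge:
  fixes f :: "real fps"
  assumes "\<And>L. fps_nth f L \<ge> 0" "0 \<le> t" "t < c" "fps_conv_radius f \<ge> ereal c"
  shows "eval_fps f t \<ge> fps_nth f 0"
proof -
  have "(\<lambda>L. fps_nth f L * t ^ L) sums eval_fps f t"
    using assms by (intro sums_eval_fps conv_less) auto
  moreover have "(\<Sum>L\<in>{0}. fps_nth f L * t ^ L) \<le> (\<Sum>L. fps_nth f L * t ^ L)"
    using assms calculation by (intro sum_le_suminf) (auto simp: sums_iff)
  ultimately show ?thesis by (simp add: sums_iff)
qed

text \<open>Nonnegative coefficients with constant term 1 give \<open>W i t \<ge> 1\<close>, and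
  \<open>W i t\<close> is the reciprocal of \<open>1 - A i t\<close>.\<close>

lemma A_less_1: "i < n \<Longrightarrow> 0 \<le> t \<Longrightarrow> t < c \<Longrightarrow> A i t < 1"
proof -
  assume *: "i < n" "0 \<le> t" "t < c"
  have "W i t \<ge> 1"
    using eval_nonneg_ge[of "return_series R i [i]" t] return_series_nonneg * conv_return_series by (simp add: W_def return_series_nth_0)
  then show ?thesis using W_eq[of i t] *
    by (smt (verit) mult_less_0_iff mult_nonneg_nonpos)
qed

lemma \<alpha>_nonneg: "adj R u v \<Longrightarrow> 0 \<le> t \<Longrightarrow> t < c \<Longrightarrow> \<alpha> u v t \<ge> 0"
  using eval_nonneg_ge[of "message_series R u v" t] message_series_nonneg conv_message_series by (simp add: message_series_0 eval_message_series)

text \<open>For \<open>t > 0\<close>, multiplication by the positive number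
  \<open>(R $$ (u, v) * t)\<^sup>2\<close> turns \<open>1 - b u v t * b v u t\<close> into
  \<open>\<alpha> u v t * (1 - A u t)\<close>, whose factors are positive. At \<open>t = 0\<close>
  both passages vanish.\<close>

lemma edge_pos:
  assumes a: "adj R u v" and t: "0 \<le> t" "t < c"
  shows "b u v t * b v u t < 1"
proof (cases "t = 0")
  case True
  then show ?thesis using b_eq[OF a, of 0] b_eq[OF adj_sym[OF a], of 0] c
    by (simp add: b_def eval_fps_at_0 passage_series_def)
next
  case False
  then have t0: "t > 0" using t by simp
  have 1: "1 - A u t > 0" using A_less_1[OF adjD(1)[OF a] t] by simp
  have rt: "(R $$ (u, v) * t)\<^sup>2 > 0" using adjD(4)[OF a] t0 by simp
  have "\<alpha> u v t \<noteq> 0" using \<alpha>_eq[OF a, of t] rt t by auto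
  then have "\<alpha> u v t > 0" using \<alpha>_nonneg[OF a t] by simp
  then have "\<alpha> u v t * (1 - A u t) > 0" using 1 by simp
  moreover have "\<alpha> u v t * (1 - A u t) = (R $$ (u, v) * t)\<^sup>2 * (1 - b u v t * b v u t)"
  proof -
    have "R $$ (u, v) * t * (b u v t * (1 - A u t)) =
        R $$ (u, v) * t * (t * R $$ (u, v) * (1 - b u v t * b v u t))"
      using b_mult_A[OF a, of t] t by simp
    then show ?thesis by (simp add: \<alpha>_def power2_eq_square mult_ac)
  qed
  ultimately show ?thesis using rt by (simp add: zero_less_mult_iff)
qed

text \<open>At \<open>t = 1\<close> this is the logarithm of \<open>Z_bp R\<close>
  (\<open>Z_bp_eq\<close>); the edge terms come from dividing each edge factor by its two vertex
  factors (\<open>Z_edge_ratio\<close>).\<close>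

definition bethe :: "real \<Rightarrow> real" where
  "bethe t = (\<Sum>(i,j)\<in>undirected_edges R. ln (1 - b i j t * b j i t)) - (\<Sum>i<n. ln (1 - A i t))"

text \<open>Weight over length of the contractible closed walks. Division by zero gives 0 at
  \<open>L = 0\<close>, so the empty walks drop out.\<close>

definition cycle_series :: "real fps" where
  "cycle_series = Abs_fps (\<lambda>L. (\<Sum>i<n. return_weight R i L [i]) / real L)"

lemma conv_cycle_series: "fps_conv_radius cycle_series \<ge> ereal c"
proof (rule fps_conv_radius_geI_bounded)
  fix L
  let ?S = "\<Sum>i<n. return_weight R i L [i]"
  have "\<bar>fps_nth cycle_series L\<bar> * c ^ L \<le> \<bar>?S\<bar> * c ^ L"
  proof (rule mult_right_mono)
    have "\<bar>?S\<bar> / real L \<le> \<bar>?S\<bar>"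
      by (cases "L = 0") (auto simp: divide_le_eq mult_le_cancel_left1)
    then show "\<bar>fps_nth cycle_series L\<bar> \<le> \<bar>?S\<bar>" by (simp add: cycle_series_def)
  qed (use c in simp)
  also have "\<dots> \<le> (\<Sum>i<n. \<bar>return_weight R i L [i]\<bar> * c ^ L)"
    using c by (auto simp flip: sum_distrib_right intro!: mult_right_mono)
  also have "\<dots> \<le> (\<Sum>i<n. C)" by (intro sum_mono bound) auto
  finally show "\<bar>fps_nth cycle_series L\<bar> * c ^ L \<le> n * C" by simp
qed (use c in simp)

text \<open>Differentiation cancels the division by the length. The renewal equation exposes a
  factor \<open>fps_X\<close> that the index shift removes, so the formula also covers
  \<open>t = 0\<close>.\<close>

lemma deriv_cycle_series:
  "fps_deriv cycle_series =
     (\<Sum>i<n. (\<Sum>k\<in>nbrs R i. fps_const (R $$ (k, i)) * passage_series R k i) * return_series R i [i])"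
proof (rule fps_ext)
  fix L
  have "fps_nth (fps_deriv cycle_series) L = (\<Sum>i<n. fps_nth (return_series R i [i]) (Suc L))"
    by (simp add: cycle_series_def return_series_def)
  also have "\<dots> = (\<Sum>i<n. fps_nth (1 + (\<Sum>k\<in>nbrs R i. message_series R k i) * return_series R i [i]) (Suc L))"
    by (subst return_series_eq) simp
  also have "\<dots> = (\<Sum>i<n. fps_nth (fps_X * ((\<Sum>k\<in>nbrs R i. fps_const (R $$ (k, i)) * passage_series R k i) * return_series R i [i])) (Suc L))"
    by (simp add: message_series_def sum_distrib_left sum_distrib_right mult_ac)
  also have "\<dots> = fps_nth (\<Sum>i<n. (\<Sum>k\<in>nbrs R i. fps_const (R $$ (k, i)) * passage_series R k i) * return_series R i [i]) L"
    by (simp add: fps_sum_nth)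
  finally show "fps_nth (fps_deriv cycle_series) L =
     fps_nth (\<Sum>i<n. (\<Sum>k\<in>nbrs R i. fps_const (R $$ (k, i)) * passage_series R k i) * return_series R i [i]) L" .
qed

lemma has_derivative_cycle_series:
  assumes t: "\<bar>t\<bar> < c"
  shows "(eval_fps cycle_series has_real_derivative
     (\<Sum>i<n. (\<Sum>k\<in>nbrs R i. R $$ (k, i) * b k i t) * W i t)) (at t)"
proof -
  have "fps_conv_radius (passage_series R k i) \<ge> ereal c" if "k \<in> nbrs R i" for k i
    using that by (intro conv_passage) (auto simp: nbrs_adj)
  then have S: "fps_conv_radius (\<Sum>k\<in>nbrs R i. fps_const (R $$ (k, i)) * passage_series R k i) \<ge> ereal c"
    and E: "eval_fps (\<Sum>k\<in>nbrs R i. fps_const (R $$ (k, i)) * passage_series R k i) t =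
       (\<Sum>k\<in>nbrs R i. R $$ (k, i) * b k i t)" for i
    using t by (auto simp: eval_mult b_def intro!: conv_sum conv_mult sum.cong eval_sum[THEN trans])
  have "eval_fps (fps_deriv cycle_series) t = (\<Sum>i<n. (\<Sum>k\<in>nbrs R i. R $$ (k, i) * b k i t) * W i t)"
    unfolding deriv_cycle_series E[symmetric] W_def using t S
    by (subst eval_sum) (auto simp: eval_mult conv_return_series intro!: sum.cong conv_mult)
  then show ?thesis
    using has_field_derivative_eval_fps[OF conv_less[OF t conv_cycle_series]] by metis
qed

text \<open>Each \<open>b' u v\<close> enters once through an edge and once through the vertex
  \<open>v\<close>, and the two contributions cancel by stationarity. What remains is the explicit
  factor \<open>t\<close> in \<open>\<alpha>\<close>.\<close>

lemma has_derivative_bethe: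
  assumes t: "0 \<le> t" "t < c"
  shows "(bethe has_real_derivative (\<Sum>i<n. (\<Sum>k\<in>nbrs R i. R $$ (k, i) * b k i t) * W i t)) (at t)"
proof -
  have t': "\<bar>t\<bar> < c" using t by simp
  define b' where "b' u v = eval_fps (fps_deriv (passage_series R u v)) t" for u v
  have db: "(b u v has_real_derivative b' u v) (at t)" if "adj R u v" for u v
    unfolding b_def[abs_def] b'_def
    using that by (intro has_field_derivative_eval_fps conv_less t' conv_passage)
  have dA: "(A i has_real_derivative (\<Sum>k\<in>nbrs R i. R $$ (k, i) * (b k i t + t * b' k i))) (at t)" for i
    unfolding A_def[abs_def] \<alpha>_def
    by (auto intro!: derivative_eq_intros db sum.cong simp: nbrs_adj algebra_simps)
  \<comment> \<open>The contribution of \<open>b' u v\<close> through the vertex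
    \<open>v\<close>.\<close>
  define g where "g u v = R $$ (u, v) * t * b' u v * W v t" for u v
  have W: "inverse (1 - A i t) = W i t" if "i < n" for i
    using W_eq[OF that t'] by (metis inverse_unique mult.commute)
  \<comment> \<open>Stationarity in the form needed here: \<open>b_mult_A\<close>, with
    \<open>W u t\<close> as the reciprocal of \<open>1 - A u t\<close>, converts edge denominators
    into vertex weights.\<close>
  have bW: "b u v t / (1 - b u v t * b v u t) = t * R $$ (u, v) * W u t" if a: "adj R u v" for u v
  proof -
    have "b u v t = t * R $$ (u, v) * (1 - b u v t * b v u t) * W u t"
      using b_mult_A[OF a t'] W_eq[OF adjD(1)[OF a] t'] by (metis mult.assoc mult.commute mult.right_neutral)
    then show ?thesis using edge_pos[OF a t] by (simp add: field_simps)
  qed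
  have dln: "((\<lambda>t. ln (1 - f t)) has_real_derivative - D / (1 - f t)) (at t)"
    if "(f has_real_derivative D) (at t)" "f t < 1" for f D
    using that by (auto intro!: derivative_eq_intros simp: divide_inverse)
  have "(bethe has_real_derivative
     (\<Sum>(i,j)\<in>undirected_edges R. - (b' i j * b j i t + b i j t * b' j i) / (1 - b i j t * b j i t)) -
     (\<Sum>i<n. - (\<Sum>k\<in>nbrs R i. R $$ (k, i) * (b k i t + t * b' k i)) / (1 - A i t))) (at t)"
    unfolding bethe_def[abs_def]
  proof (intro DERIV_diff DERIV_sum)
    fix e assume "e \<in> undirected_edges R"
    then obtain i j where e: "e = (i, j)" and a: "adj R i j" by (auto simp: undirected_edges_def)
    have "((\<lambda>t. b i j t * b j i t) has_real_derivative b' i j * b j i t + b i j t * b' j i) (at t)"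
      by (auto intro!: derivative_eq_intros db a adj_sym[OF a])
    from dln[OF this edge_pos[OF a t]]
    show "((\<lambda>t. case e of (i, j) \<Rightarrow> ln (1 - b i j t * b j i t)) has_real_derivative
        (case e of (i, j) \<Rightarrow> - (b' i j * b j i t + b i j t * b' j i) / (1 - b i j t * b j i t))) (at t)"
      by (simp add: e)
  next
    fix i assume "i \<in> {..<n}"
    then show "((\<lambda>t. ln (1 - A i t)) has_real_derivative
        - (\<Sum>k\<in>nbrs R i. R $$ (k, i) * (b k i t + t * b' k i)) / (1 - A i t)) (at t)"
      using A_less_1 t by (intro dln dA) auto
  qed
  moreover have "(\<Sum>(i,j)\<in>undirected_edges R. - (b' i j * b j i t + b i j t * b' j i) / (1 - b i j t * b j i t)) =
      - (\<Sum>(i,j)\<in>undirected_edges R. g i j + g j i)"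
    unfolding sum_negf[symmetric] case_prod_unfold
  proof (intro sum.cong refl)
    fix e assume "e \<in> undirected_edges R"
    then obtain i j where e: "e = (i, j)" and a: "adj R i j" by (auto simp: undirected_edges_def)
    have "- (b' i j * b j i t + b i j t * b' j i) / (1 - b i j t * b j i t) =
       - (b' i j * (b j i t / (1 - b j i t * b i j t)) + b' j i * (b i j t / (1 - b i j t * b j i t)))"
      by (simp add: add_divide_distrib diff_divide_distrib mult.commute)
    also have "\<dots> = - (g i j + g j i)"
      unfolding bW[OF a] bW[OF adj_sym[OF a]] g_def using adjD(5)[OF a] by simp
    finally show "- (b' (fst e) (snd e) * b (snd e) (fst e) t + b (fst e) (snd e) t * b' (snd e) (fst e)) /
      (1 - b (fst e) (snd e) t * b (snd e) (fst e) t) = - (g (fst e) (snd e) + g (snd e) (fst e))"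
      by (simp add: e)
  qed
  moreover have "(\<Sum>i<n. - (\<Sum>k\<in>nbrs R i. R $$ (k, i) * (b k i t + t * b' k i)) / (1 - A i t)) =
      - (\<Sum>i<n. (\<Sum>k\<in>nbrs R i. R $$ (k, i) * b k i t) * W i t) - (\<Sum>i<n. \<Sum>k\<in>nbrs R i. g k i)"
  proof -
    have "(\<Sum>k\<in>nbrs R i. R $$ (k, i) * (b k i t + t * b' k i)) * W i t =
       (\<Sum>k\<in>nbrs R i. R $$ (k, i) * b k i t) * W i t + (\<Sum>k\<in>nbrs R i. g k i)" for i
      by (simp add: g_def distrib_left distrib_right sum.distrib sum_distrib_left mult_ac)
    then show ?thesis by (simp add: divide_inverse W sum_subtractf sum_negf)
  qed
  ultimately show ?thesis by (simp add: sum_undirected_edges)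
qed

text \<open>Both sides vanish at 0 and have the same derivative on \<open>[0, 1]\<close>.\<close>

lemma bethe_eq_cycle_series: "bethe 1 = eval_fps cycle_series 1"
proof -
  have "\<exists>k. \<forall>t\<in>{0..1}. bethe t - eval_fps cycle_series t = k"
  proof (rule has_field_derivative_zero_constant)
    fix t :: real assume "t \<in> {0..1}"
    then have t: "0 \<le> t" "t < c" "\<bar>t\<bar> < c" using c by auto
    show "((\<lambda>t. bethe t - eval_fps cycle_series t) has_real_derivative 0) (at t within {0..1})"
      using DERIV_diff[OF has_derivative_bethe[OF t(1,2)] has_derivative_cycle_series[OF t(3)]]
      by (auto intro: DERIV_subset)
  qed simp
  then have "bethe 1 - eval_fps cycle_series 1 = bethe 0 - eval_fps cycle_series 0" by force
  moreover have "bethe 0 = 0"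
    by (simp add: bethe_def A_def \<alpha>_def b_def eval_fps_at_0 passage_series_def)
  moreover have "eval_fps cycle_series 0 = 0"
    by (simp add: eval_fps_at_0 cycle_series_def)
  ultimately show ?thesis by simp
qed

end

section \<open>The messages and the estimate\<close>

lemma det_2x2: "Determinant.det (mat_of_rows_list 2 [[a, b], [c, d]]) = a * d - b * (c :: real)"
proof -
  let ?M = "mat_of_rows_list 2 [[a, b], [c, d]]"
  have M: "?M \<in> carrier_mat 2 2" by (rule carrier_matI) (simp_all add: mat_of_rows_list_def)
  have "Determinant.det ?M = (\<Sum>j<2. ?M $$ (0, j) * cofactor ?M 0 j)"
    by (rule laplace_expansion_row[OF M]) simp
  also have "\<dots> = a * d - b * c"
    by (simp add: numeral_2_eq_2 cofactor_def mat_delete_def mat_of_rows_list_def det_single)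
  finally show ?thesis .
qed

text \<open>Both sequences start with 0, so nonzero terms have both indices at least 1, and
  \<open>i + j \<le> Suc m\<close> then bounds each by \<open>m\<close>. The gain of one degree
  matches one step of the message iteration.\<close>

lemma sum_convolution_le:
  fixes f g :: "nat \<Rightarrow> real"
  assumes "f 0 = 0" "g 0 = 0" "\<And>i. f i \<ge> 0" "\<And>i. g i \<ge> 0"
  shows "(\<Sum>L\<le>Suc m. \<Sum>i\<le>L. f i * g (L - i)) \<le> (\<Sum>i\<le>m. f i) * (\<Sum>i\<le>m. g i)"
proof -
  have fin: "finite {(i, j). i + j \<le> Suc m}"
    by (rule finite_subset[of _ "{..Suc m} \<times> {..Suc m}"]) auto
  have "(\<Sum>L\<le>Suc m. \<Sum>i\<le>L. f i * g (L - i)) = (\<Sum>(i, j)\<in>{(i, j). i + j \<le> Suc m}. f i * g j)"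
    by (rule sum.triangle_reindex_eq[symmetric])
  also have "\<dots> = (\<Sum>(i, j)\<in>{(i, j). i + j \<le> Suc m \<and> i \<noteq> 0 \<and> j \<noteq> 0}. f i * g j)"
    using fin by (intro sum.mono_neutral_right) (auto simp: assms intro!: gr0I)
  also have "\<dots> \<le> (\<Sum>(i, j)\<in>{..m} \<times> {..m}. f i * g j)"
    by (intro sum_mono2) (auto simp: assms)
  also have "\<dots> = (\<Sum>i\<le>m. f i) * (\<Sum>i\<le>m. g i)"
    by (simp add: sum_product sum.cartesian_product)
  finally show ?thesis .
qed

section \<open>Limit of the message iteration\<close>

context convergent_weights begin

lemma message_series_partial_sum_Suc_le:
  assumes a: "adj R u v"
  shows "(\<Sum>L\<le>Suc m. fps_nth (message_series R u v) L) \<le> (R $$ (u, v))\<^sup>2 +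
    (\<Sum>L\<le>m. fps_nth (message_series R u v) L) * (\<Sum>k\<in>nbrs R u - {v}. \<Sum>L\<le>m. fps_nth (message_series R k u) L)"
proof -
  let ?g = "\<lambda>L. \<Sum>k\<in>nbrs R u - {v}. fps_nth (message_series R k u) L"
  have "(\<Sum>L\<le>Suc m. fps_nth (message_series R u v) L) = (\<Sum>L\<le>Suc m. if L = 2 then (R $$ (u, v))\<^sup>2 else 0) +
      (\<Sum>L\<le>Suc m. \<Sum>i\<le>L. fps_nth (message_series R u v) i * ?g (L - i))"
    unfolding sum.distrib[symmetric] by (intro sum.cong refl message_series_nth[OF a, unfolded atLeast0AtMost])
  also have "\<dots> \<le> (R $$ (u, v))\<^sup>2 + (\<Sum>i\<le>m. fps_nth (message_series R u v) i) * (\<Sum>i\<le>m. ?g i)"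
    using a by (intro add_mono sum_convolution_le)
      (auto simp: message_series_0 message_series_nonneg nbrs_adj intro!: sum_nonneg)
  also have "(\<Sum>i\<le>m. ?g i) = (\<Sum>k\<in>nbrs R u - {v}. \<Sum>L\<le>m. fps_nth (message_series R k u) L)"
    by (rule sum.swap)
  finally show ?thesis .
qed

lemma \<alpha>_1:
  assumes a: "adj R u v"
  shows "\<alpha> u v 1 \<ge> 0" "\<alpha> u v 1 > 0" "1 - (\<Sum>k\<in>nbrs R u - {v}. \<alpha> k u 1) > 0"
    "\<alpha> u v 1 = (R $$ (u, v))\<^sup>2 * inverse (1 - (\<Sum>k\<in>nbrs R u - {v}. \<alpha> k u 1))"
proof -
  let ?S = "\<Sum>k\<in>nbrs R u - {v}. \<alpha> k u 1"
  show 0: "\<alpha> u v 1 \<ge> 0" using \<alpha>_nonneg[OF a] c by simp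
  have eq: "\<alpha> u v 1 * (1 - ?S) = (R $$ (u, v))\<^sup>2"
    unfolding \<alpha>_excl_eq[OF a] using \<alpha>_eq[OF a, of 1] c by (simp add: algebra_simps)
  then have "\<alpha> u v 1 * (1 - ?S) > 0" using adjD(4)[OF a] by simp
  with 0 show "\<alpha> u v 1 > 0" and S: "1 - ?S > 0" by (auto simp: zero_less_mult_iff)
  show "\<alpha> u v 1 = (R $$ (u, v))\<^sup>2 * inverse (1 - ?S)"
    using eq S by (simp add: field_simps)
qed

text \<open>The update is monotone with fixed point \<open>\<alpha>\<close>, which gives the upper
  bound; each update gains at least one degree of the series, which gives the lower one. Together
  they squeeze the iterates to their limit.\<close>

lemma alpha_iter_bounds:
  "adj R u v \<Longrightarrow> 0 \<le> alpha_iter R t u v \<and> alpha_iter R t u v \<le> \<alpha> u v 1 \<and>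
     (\<Sum>L\<le>t. fps_nth (message_series R u v) L) \<le> alpha_iter R t u v"
proof (induction t arbitrary: u v)
  case 0
  then show ?case by (simp add: message_series_0 \<alpha>_1(1))
next
  case (Suc t)
  let ?N = "nbrs R u - {v}" and ?x = "alpha_iter R (Suc t) u v" and ?r = "(R $$ (u, v))\<^sup>2"
  let ?S = "\<Sum>k\<in>?N. alpha_iter R t k u"
  have S: "0 \<le> ?S" "?S \<le> (\<Sum>k\<in>?N. \<alpha> k u 1)" "(\<Sum>k\<in>?N. \<Sum>L\<le>t. fps_nth (message_series R k u) L) \<le> ?S"
    using Suc.IH by (auto intro!: sum_nonneg sum_mono simp: nbrs_adj)
  have pos: "1 - ?S > 0" using S(2) \<alpha>_1(3)[OF Suc.prems] by simp
  have x0: "?x \<ge> 0" using pos by simp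
  have "?x \<le> \<alpha> u v 1"
    unfolding \<alpha>_1(4)[OF Suc.prems] alpha_iter.simps
    using S(2) \<alpha>_1(3)[OF Suc.prems] by (intro mult_left_mono le_imp_inverse_le) auto
  \<comment> \<open>The update in fixed-point form. A second induction, on the degree
    \<open>m\<close>, compares it with the recursive inequality for the partial sums.\<close>
  have x: "?r + ?x * ?S = ?x" using pos by (simp add: field_simps)
  have "(\<Sum>L\<le>m. fps_nth (message_series R u v) L) \<le> ?x" if "m \<le> Suc t" for m
    using that
  proof (induction m)
    case 0
    then show ?case using x0 by (simp add: message_series_0)
  next
    case (Suc m)
    have "(\<Sum>k\<in>?N. \<Sum>L\<le>m. fps_nth (message_series R k u) L) \<le> (\<Sum>k\<in>?N. \<Sum>L\<le>t. fps_nth (message_series R k u) L)"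
      using Suc.prems by (intro sum_mono sum_mono2) (auto simp: message_series_nonneg nbrs_adj)
    also note S(3)
    finally have "(\<Sum>L\<le>m. fps_nth (message_series R u v) L) * (\<Sum>k\<in>?N. \<Sum>L\<le>m. fps_nth (message_series R k u) L) \<le> ?x * ?S"
      using Suc.IH Suc.prems x0
      by (intro mult_mono) (auto intro!: sum_nonneg simp: message_series_nonneg nbrs_adj simp del: alpha_iter.simps)
    then show ?case
      using message_series_partial_sum_Suc_le[OF \<open>adj R u v\<close>, of m] x by linarith
  qed
  then show ?case using x0 \<open>?x \<le> \<alpha> u v 1\<close> by blast
qed

lemma alpha_eq: "adj R u v \<Longrightarrow> alpha R u v = \<alpha> u v 1"
  unfolding alpha_def
proof (rule limI)
  assume a: "adj R u v"
  have "(\<lambda>L. fps_nth (message_series R u v) L * 1 ^ L) sums eval_fps (message_series R u v) 1"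
    using c a by (intro sums_eval_fps conv_less conv_message_series) auto
  then have "(\<lambda>t. \<Sum>L\<le>t. fps_nth (message_series R u v) L) \<longlonglongrightarrow> \<alpha> u v 1"
    using c a by (simp add: eval_message_series sums_def_le)
  then show "(\<lambda>t. alpha_iter R t u v) \<longlonglongrightarrow> \<alpha> u v 1"
    by (rule tendsto_sandwich[rotated 2, OF _ tendsto_const]) (auto simp: alpha_iter_bounds a)
qed

lemma sum_alpha_eq: "(\<Sum>k\<in>nbrs R i - S. alpha R k i) = (\<Sum>k\<in>nbrs R i - S. \<alpha> k i 1)"
  by (intro sum.cong) (auto simp: alpha_eq nbrs_adj)

section \<open>Local factors of the estimate\<close>

lemma Z_node_eq: "Z_node R i = inverse (1 - A i 1)"
  using sum_alpha_eq[of i "{}"] by (simp add: Z_node_def A_def)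

lemma Z_edge_ratio:
  assumes a: "adj R i j"
  shows "Z_edge R i j / (Z_node R i * Z_node R j) = 1 - b i j 1 * b j i 1"
proof -
  define p q x y r where d: "p = 1 - A i 1" "q = 1 - A j 1" "x = \<alpha> i j 1" "y = \<alpha> j i 1" "r = R $$ (i, j)"
  note a' = adj_sym[OF a]
  have pos: "p > 0" "q > 0" "x > 0" "y > 0"
    using A_less_1 adjD(1,2)[OF a] \<alpha>_1(2)[OF a] \<alpha>_1(2)[OF a'] c by (auto simp: d)
  have r: "r \<noteq> 0" "R $$ (j, i) = r" using adjD(4,5)[OF a] by (auto simp: d)
  have e1: "x * (p + y) = r\<^sup>2" using \<alpha>_eq[OF a, of 1] c by (simp add: d)
  have e2: "y * (q + x) = r\<^sup>2" using \<alpha>_eq[OF a', of 1] c r by (simp add: d)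
  have ex: "alpha_excl R i j = A i 1 - y" "alpha_excl R j i = A j 1 - x"
    using \<alpha>_excl_eq[OF a, of 1] \<alpha>_excl_eq[OF a', of 1]
    by (simp_all add: alpha_excl_def sum_alpha_eq d)
  have "Z_edge R i j = inverse ((p + y) * (q + x) - r\<^sup>2)"
    by (simp add: Z_edge_def det_2x2 ex d power2_eq_square algebra_simps)
  \<comment> \<open>The fixed-point equation \<open>x * (p + y) = r\<^sup>2\<close> makes the
    determinant factorise.\<close>
  also have "(p + y) * (q + x) - r\<^sup>2 = (p + y) * q"
    unfolding e1[symmetric] by (simp add: algebra_simps)
  finally have "Z_edge R i j / (Z_node R i * Z_node R j) = p / (p + y)"
    using pos by (simp add: Z_node_eq flip: d) (simp add: field_simps)
  also have "\<dots> = 1 - b i j 1 * b j i 1"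
  proof -
    \<comment> \<open>Replacing \<open>r\<^sup>2\<close> by \<open>x * (p + y)\<close> and
      cancelling \<open>x\<close> identifies \<open>y / (p + y)\<close> with the product of the two
      passages.\<close>
    have "x * y = r\<^sup>2 * (b i j 1 * b j i 1)"
      using r by (simp add: d \<alpha>_def power2_eq_square)
    then have "x * y = x * ((p + y) * (b i j 1 * b j i 1))" by (simp flip: e1)
    then have "y = (p + y) * (b i j 1 * b j i 1)" using pos by simp
    then show ?thesis using pos by (simp add: field_simps)
  qed
  finally show ?thesis .
qed

lemma Z_bp_eq: "Z_bp R = exp (bethe 1)"
proof -
  have 1: "(\<Prod>i<n. Z_node R i) = exp (- (\<Sum>i<n. ln (1 - A i 1)))"
    using A_less_1 c by (simp add: sum_negf[symmetric] exp_sum Z_node_eq exp_minus del: sum_negf)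
  have 2: "(\<Prod>(i,j)\<in>undirected_edges R. Z_edge R i j / (Z_node R i * Z_node R j)) =
     exp (\<Sum>(i,j)\<in>undirected_edges R. ln (1 - b i j 1 * b j i 1))"
  proof -
    have "finite (undirected_edges R)"
      by (rule finite_subset[of _ "{..<n} \<times> {..<n}"]) (auto simp: undirected_edges_def adjD)
    then show ?thesis
      using edge_pos c by (auto simp: exp_sum undirected_edges_def Z_edge_ratio intro!: prod.cong)
  qed
  show ?thesis unfolding Z_bp_def bethe_def by (simp add: 1 2 exp_diff exp_minus field_simps)
qed

lemma ln_Z_bp_sums:
  "(\<lambda>L. (\<Sum>i<n. return_weight R i L [i]) / real L) sums ln (Z_bp R)"
proof -
  have "(\<lambda>L. fps_nth cycle_series L * 1 ^ L) sums eval_fps cycle_series 1"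
    using c by (intro sums_eval_fps conv_less conv_cycle_series) auto
  then show ?thesis by (simp add: Z_bp_eq bethe_eq_cycle_series cycle_series_def)
qed

end

section \<open>Cyclic words\<close>

definition power_word :: "'a list \<Rightarrow> nat \<Rightarrow> 'a list" where
  "power_word xs m = concat (replicate m xs)"

definition primitive_word :: "'a list \<Rightarrow> bool" where
  "primitive_word xs \<longleftrightarrow> xs \<noteq> [] \<and> (\<forall>d m. xs = power_word d m \<longrightarrow> m = 1)"

lemma power_word_0 [simp]: "power_word xs 0 = []"
  and power_word_Suc: "power_word xs (Suc m) = xs @ power_word xs m"
  and power_word_1 [simp]: "power_word xs (Suc 0) = xs"
  by (auto simp: power_word_def)

lemma power_word_Suc': "power_word xs (Suc m) = power_word xs m @ xs"
  by (induction m) (auto simp: power_word_Suc)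

lemma length_power_word [simp]: "length (power_word xs m) = m * length xs"
  by (simp add: power_word_def length_concat_replicate)

lemma power_word_eq_Nil [simp]: "power_word xs m = [] \<longleftrightarrow> m = 0 \<or> xs = []"
  by (auto simp: power_word_def)

lemma last_power_word: "m > 0 \<Longrightarrow> xs \<noteq> [] \<Longrightarrow> last (power_word xs m) = last xs"
  by (cases m) (auto simp: power_word_Suc')

lemma power_word_add: "power_word xs (m + k) = power_word xs m @ power_word xs k"
  by (simp add: power_word_def replicate_add)

lemma power_word_mult: "power_word (power_word xs m) k = power_word xs (m * k)"
  by (induction k) (auto simp: power_word_Suc power_word_add)

lemma rotate1_power_word: "rotate1 (power_word xs m) = power_word (rotate1 xs) m"
proof (cases xs)
  case (Cons a ys)
  have *: "power_word (a # ys) m @ [a] = a # power_word (ys @ [a]) m" for m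
    by (induction m) (auto simp: power_word_Suc)
  show ?thesis
    by (cases m) (auto simp: Cons power_word_Suc *)
qed (simp add: power_word_def)

lemma rotate_power_word: "rotate k (power_word xs m) = power_word (rotate k xs) m"
  by (induction k) (auto simp: rotate1_power_word)

lemma rotate_back: "\<exists>j. rotate j (rotate k xs) = xs"
proof (cases "xs = []")
  case False
  have "rotate ((length xs - 1) * k) (rotate k xs) = rotate (length xs * k) xs"
    using False by (cases "length xs") (auto simp: rotate_rotate algebra_simps)
  then show ?thesis by (metis mod_mult_self1_is_0 rotate_id)
qed simp

lemma primitive_word_rotate: "primitive_word xs \<Longrightarrow> primitive_word (rotate k xs)"
  unfolding primitive_word_def by (metis rotate_back rotate_power_word rotate_is_Nil_conv)

lemma rotate_cancel: "rotate k xs = rotate k ys \<Longrightarrow> xs = ys"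
  by (induction k) (auto dest: injD[OF inj_rotate1])

text \<open>A word fixed by a proper rotation is a product of two commuting nonempty words, hence a
  proper power.\<close>

lemma primitive_word_rotate_neq:
  assumes "primitive_word xs" "0 < k" "k < length xs"
  shows "rotate k xs \<noteq> xs"
proof
  assume "rotate k xs = xs"
  then have eq: "drop k xs @ take k xs = xs"
    using assms(3) by (simp add: rotate_drop_take)
  then have "drop k xs @ take k xs = take k xs @ drop k xs" by simp
  moreover have "drop k xs \<noteq> []" "take k xs \<noteq> []" using assms by auto
  ultimately obtain m d where "m > 1" "power_word d m = drop k xs @ take k xs"
    using comm_append_is_replicate unfolding power_word_def by blast
  then have "m > 1" "xs = power_word d m" using eq by auto
  then show False using assms(1) by (auto simp: primitive_word_def)
qed

lemma inj_on_rotate_primitive: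
  assumes "primitive_word xs"
  shows "inj_on (\<lambda>k. rotate k xs) {..<length xs}"
proof (rule linorder_inj_onI)
  fix i j assume *: "i < j" "i \<in> {..<length xs}" "j \<in> {..<length xs}"
  show "rotate i xs \<noteq> rotate j xs"
  proof
    assume "rotate i xs = rotate j xs"
    also have "\<dots> = rotate i (rotate (j - i) xs)" using * by (simp add: rotate_rotate)
    finally have "xs = rotate (j - i) xs" by (rule rotate_cancel)
    moreover have "rotate (j - i) xs \<noteq> xs"
      using * by (intro primitive_word_rotate_neq[OF assms]) auto
    ultimately show False by metis
  qed
qed auto

lemma ex_primitive_root:
  "xs \<noteq> [] \<Longrightarrow> \<exists>u m. primitive_word u \<and> m > 0 \<and> xs = power_word u m"
proof (induction "length xs" arbitrary: xs rule: less_induct)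
  case less
  show ?case
  proof (cases "primitive_word xs")
    case True
    then show ?thesis by (intro exI[of _ xs] exI[of _ 1]) auto
  next
    case False
    then obtain d m where d: "xs = power_word d m" "m \<noteq> 1"
      using less.prems by (auto simp: primitive_word_def)
    then have "m > 1" "d \<noteq> []" using less.prems by (auto intro: Suc_lessI)
    then obtain u k where "primitive_word u" "k > 0" "d = power_word u k"
      using less.hyps[of d] d by auto
    then show ?thesis using d \<open>m > 1\<close>
      by (intro exI[of _ u] exI[of _ "k * m"]) (auto simp: power_word_mult)
  qed
qed

text \<open>Equal powers of \<open>u\<close> and \<open>v\<close> commute with both of them, so that \<open>u @ v\<close> and \<open>v @ u\<close> are
  prefixes of the same word and hence equal.\<close>

lemma primitive_root_unique:
  assumes "primitive_word u" "primitive_word v" "power_word u m = power_word v k" "m > 0" "k > 0"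
  shows "u = v \<and> m = k"
proof -
  define p where "p = power_word u m"
  have ne: "u \<noteq> []" "v \<noteq> []" using assms by (auto simp: primitive_word_def)
  obtain a b where u: "p = u @ a" and v: "p = v @ b"
    unfolding p_def using assms by (metis gr0_implies_Suc power_word_Suc)
  have cu: "u @ p = p @ u" unfolding p_def by (metis power_word_Suc power_word_Suc')
  have cv: "v @ p = p @ v" unfolding p_def assms(3) by (metis power_word_Suc power_word_Suc')
  have "p @ p = (u @ v) @ (b @ a)" by (metis append.assoc cu u v)
  moreover have "p @ p = (v @ u) @ (a @ b)" by (metis append.assoc cv u v)
  ultimately have "u @ v = v @ u"
    by (metis add.commute append_eq_append_conv length_append)
  then obtain i j z where z: "power_word z i = u" "power_word z j = v"
    using comm_append_are_replicate unfolding power_word_def by metis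
  then have "i = 1" "j = 1" using assms by (auto simp: primitive_word_def)
  then have uv: "u = v" using z by simp
  have "m * length u = k * length v" using assms(3) by (metis length_power_word)
  then show ?thesis using uv ne by simp
qed

text \<open>A closed walk is encoded by its vertices without the initial one, which equals the last.
  Cyclic shifts become list rotations and repeated walks become powers of words.\<close>

definition cyclic_walk :: "nat list \<Rightarrow> nat list" where
  "cyclic_walk xs = last xs # xs"

lemma tl_cyclic_walk [simp]: "tl (cyclic_walk xs) = xs"
  by (simp add: cyclic_walk_def)

lemma length_cyclic_walk [simp]: "length (cyclic_walk xs) = Suc (length xs)"
  by (simp add: cyclic_walk_def)

lemma cyclic_walk_inject [simp]: "cyclic_walk xs = cyclic_walk ys \<longleftrightarrow> xs = ys"
  by (metis tl_cyclic_walk)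

lemma walk_from_append: "walk_from R u (xs @ ys) \<longleftrightarrow> walk_from R u xs \<and> walk_from R (last (u # xs)) ys"
  by (induction xs arbitrary: u) auto

lemma walk_Cons: "walk R (u # xs) \<longleftrightarrow> walk_from R u xs"
proof (induction xs arbitrary: u)
  case (Cons v xs)
  have "walk R (u # v # xs) \<longleftrightarrow> adj R u v \<and> walk R (v # xs)"
    unfolding walk_def by (simp add: All_less_Suc2)
  then show ?case by (simp add: Cons)
qed (simp add: walk_def)

lemma closed_walk_iff: "closed_walk R w \<longleftrightarrow> (\<exists>xs. xs \<noteq> [] \<and> walk_from R (last xs) xs \<and> w = cyclic_walk xs)"
proof (cases w)
  case (Cons u xs)
  then show ?thesis by (cases xs) (auto simp: closed_walk_def walk_Cons cyclic_walk_def)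
qed (simp add: closed_walk_def cyclic_walk_def)

lemma walk_pow_cyclic_walk:
  "xs \<noteq> [] \<Longrightarrow> m > 0 \<Longrightarrow> walk_pow (cyclic_walk xs) m = cyclic_walk (power_word xs m)"
  by (simp add: walk_pow_def cyclic_walk_def last_power_word) (simp add: power_word_def)

lemma primitive_walk_cyclic_walk:
  "primitive_walk R (cyclic_walk xs) \<longleftrightarrow> walk_from R (last xs) xs \<and> primitive_word xs"
proof (intro iffI conjI)
  assume p: "primitive_walk R (cyclic_walk xs)"
  then show path: "walk_from R (last xs) xs" by (auto simp: primitive_walk_def closed_walk_iff)
  have ne: "xs \<noteq> []" using p by (auto simp: primitive_walk_def closed_walk_iff)
  have "m = 1" if d: "xs = power_word d m" for d m
  proof (rule ccontr)
    assume "m \<noteq> 1"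
    then have m: "m \<ge> 2" "d \<noteq> []" using d ne by (auto simp: numeral_2_eq_2 intro!: Suc_leI Suc_lessI)
    \<comment> \<open>Any root \<open>d\<close> of the word is itself closed: as a prefix it starts
      from \<open>last xs\<close>, which is also its own last vertex.\<close>
    have "xs = d @ power_word d (m - 1)" using d m by (cases m) (auto simp: power_word_Suc)
    then have "walk_from R (last xs) d" using path by (metis walk_from_append)
    then have "walk_from R (last d) d" using d m last_power_word[of m d] by simp
    then have "closed_walk R (cyclic_walk d)" using m by (auto simp: closed_walk_iff)
    moreover have "length (cyclic_walk d) < length (cyclic_walk xs)"
      using d m by (simp add: cyclic_walk_def)
    moreover have "cyclic_walk xs = walk_pow (cyclic_walk d) m"
      using d m by (simp add: walk_pow_cyclic_walk)
    ultimately show False using p m(1) unfolding primitive_walk_def by blast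
  qed
  then show "primitive_word xs" using ne by (simp add: primitive_word_def)
next
  assume a: "walk_from R (last xs) xs \<and> primitive_word xs"
  then have ne: "xs \<noteq> []" by (simp add: primitive_word_def)
  show "primitive_walk R (cyclic_walk xs)"
    unfolding primitive_walk_def
  proof (intro conjI notI)
    show "closed_walk R (cyclic_walk xs)" using a ne by (auto simp: closed_walk_iff)
    assume "\<exists>u m. 2 \<le> m \<and> closed_walk R u \<and> length u < length (cyclic_walk xs) \<and> cyclic_walk xs = walk_pow u m"
    then obtain d m where "m \<ge> 2" "d \<noteq> []" "cyclic_walk xs = walk_pow (cyclic_walk d) m"
      by (auto simp: closed_walk_iff)
    then have m: "m \<ge> 2" and "xs = power_word d m" by (auto simp: walk_pow_cyclic_walk)
    then have "m = 1" using a unfolding primitive_word_def by blast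
    with m show False by simp
  qed
qed

lemma cyc_shift_cyclic_walk:
  "k < length xs \<Longrightarrow> cyc_shift k (cyclic_walk xs) = cyclic_walk (rotate k xs)"
proof (cases k)
  case (Suc j)
  assume k: "k < length xs"
  \<comment> \<open>For \<open>k = Suc j\<close> the shifted walk starts at \<open>xs ! j\<close>,
    one position before \<open>drop k xs\<close>, because of the prepended initial vertex.\<close>
  have "drop j xs = xs ! j # drop k xs" using k Suc by (simp add: Cons_nth_drop_Suc)
  moreover have "last (drop k xs @ take k xs) = xs ! j"
    using k Suc by (simp add: take_Suc_conv_app_nth)
  ultimately show ?thesis
    using k Suc by (simp add: cyc_shift_def cyclic_walk_def rotate_drop_take)
qed (simp add: cyc_shift_def cyclic_walk_def)

lemma orbit_of_cyclic_walk:
  assumes "xs \<noteq> []"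
  shows "orbit_of (cyclic_walk xs) = (\<lambda>k. cyclic_walk (rotate k xs)) ` {..<length xs}"
proof -
  have "length (cyclic_walk xs) - 1 = length xs" by (simp add: cyclic_walk_def)
  then show ?thesis unfolding orbit_of_def by (force simp: cyc_shift_cyclic_walk)
qed

lemma orbit_of_cyclic_walk_range:
  assumes "xs \<noteq> []"
  shows "orbit_of (cyclic_walk xs) = range (\<lambda>k. cyclic_walk (rotate k xs))"
proof -
  have "cyclic_walk (rotate k xs) \<in> (\<lambda>k. cyclic_walk (rotate k xs)) ` {..<length xs}" for k
    using assms by (subst rotate_conv_mod) auto
  then show ?thesis using assms by (auto simp: orbit_of_cyclic_walk)
qed

lemma cyclic_walk_in_orbit_of: "xs \<noteq> [] \<Longrightarrow> cyclic_walk xs \<in> orbit_of (cyclic_walk xs)"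
  using rangeI[of "\<lambda>k. cyclic_walk (rotate k xs)" 0] by (simp add: orbit_of_cyclic_walk_range)

lemma orbit_of_rotate:
  assumes "xs \<noteq> []"
  shows "orbit_of (cyclic_walk (rotate k xs)) = orbit_of (cyclic_walk xs)"
proof -
  have sub: "orbit_of (cyclic_walk (rotate k ys)) \<subseteq> orbit_of (cyclic_walk ys)" if "ys \<noteq> []" for k ys
    using that by (auto simp: orbit_of_cyclic_walk_range rotate_rotate)
  obtain j where "rotate j (rotate k xs) = xs" using rotate_back by blast
  with sub[of "rotate k xs" j] sub[OF assms, of k] assms show ?thesis by auto
qed

lemma card_orbit_of:
  assumes "primitive_word xs"
  shows "card (orbit_of (cyclic_walk xs)) = length xs" "finite (orbit_of (cyclic_walk xs))"
proof -
  have ne: "xs \<noteq> []" using assms by (simp add: primitive_word_def)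
  have "inj_on (\<lambda>k. cyclic_walk (rotate k xs)) {..<length xs}"
    using inj_on_rotate_primitive[OF assms] by (simp add: inj_on_def)
  then show "card (orbit_of (cyclic_walk xs)) = length xs" "finite (orbit_of (cyclic_walk xs))"
    using ne by (simp_all add: orbit_of_cyclic_walk card_image)
qed

section \<open>Weights of closed walks under rotation and powers\<close>

lemma weight_snoc: "weight R u (xs @ [v]) = weight R u xs * R $$ (last (u # xs), v)"
  by (induction xs arbitrary: u) auto

lemma weight_append: "weight R u (xs @ ys) = weight R u xs * weight R (last (u # xs)) ys"
  by (induction xs arbitrary: u) auto

lemma weight_eq_prod_steps: "weight R u xs = prod_list (map (($$) R) (steps (u # xs)))"
  by (induction xs arbitrary: u) (auto simp: steps_Cons)

lemma walk_from_iff_steps: "walk_from R u xs \<longleftrightarrow> (\<forall>(i, j)\<in>set (steps (u # xs)). adj R i j)"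
  by (induction xs arbitrary: u) (auto simp: steps_Cons)

definition cyclic_weight :: "real mat \<Rightarrow> nat list \<Rightarrow> real" where
  "cyclic_weight R xs = weight R (last xs) xs"

lemma cyclic_weight_rotate: "cyclic_weight R (rotate k xs) = cyclic_weight R xs"
proof (induction k)
  case (Suc k)
  have "cyclic_weight R (rotate1 ys) = cyclic_weight R ys" for ys
  proof (cases ys)
    case (Cons a zs)
    then show ?thesis by (cases zs) (auto simp: cyclic_weight_def weight_snoc)
  qed simp
  then show ?case using Suc by simp
qed simp

lemma weight_power_word:
  "xs \<noteq> [] \<Longrightarrow> weight R (last xs) (power_word xs m) = weight R (last xs) xs ^ m"
  by (induction m) (auto simp: power_word_Suc weight_append)

lemma cyclic_weight_power_word:
  "xs \<noteq> [] \<Longrightarrow> m > 0 \<Longrightarrow> cyclic_weight R (power_word xs m) = cyclic_weight R xs ^ m"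
  by (simp add: cyclic_weight_def last_power_word weight_power_word)

lemma prod_list_map_eq_prod_power:
  fixes f :: "'a \<Rightarrow> 'b :: comm_monoid_mult"
  assumes "finite A" "set xs \<subseteq> A"
  shows "prod_list (map f xs) = (\<Prod>x\<in>A. f x ^ count_list xs x)"
  using assms(2)
proof (induction xs)
  case (Cons y xs)
  have "(\<Prod>x\<in>A. f x ^ count_list (y # xs) x) = (\<Prod>x\<in>A. (if x = y then f x else 1) * f x ^ count_list xs x)"
    by (intro prod.cong) auto
  also have "\<dots> = (\<Prod>x\<in>A. if x = y then f x else 1) * (\<Prod>x\<in>A. f x ^ count_list xs x)"
    by (rule prod.distrib)
  also have "(\<Prod>x\<in>A. if x = y then f x else 1) = f y"
    using assms(1) Cons.prems by (simp add: prod.delta)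
  finally show ?case using Cons by simp
qed simp

section \<open>Totally backtracking orbits\<close>

text \<open>Conjugation by the step from \<open>last xs\<close> to the first vertex. Contractibility
  is assumed for every stack, so it can be used at \<open>push \<sigma> (last xs)\<close>.\<close>

lemma null_walk_rotate1:
  assumes "xs \<noteq> []" "null_walk (last xs) xs"
  shows "null_walk (last (rotate1 xs)) (rotate1 xs)"
proof -
  obtain a zs where xs: "xs = a # zs" using assms(1) by (cases xs) auto
  have "foldl push \<sigma> (zs @ [a]) = \<sigma>" if \<sigma>: "\<sigma> \<in> lifts a" for \<sigma>
  proof -
    have "foldl push (push \<sigma> (last xs)) xs = push \<sigma> (last xs)"
      using assms(2) push_lifts[OF \<sigma>] by (auto simp: null_walk_def)
    then have "foldl push \<sigma> zs = push \<sigma> (last xs)"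
      using push_push[OF \<sigma>] by (simp add: xs)
    then show ?thesis using push_push[OF \<sigma>] by simp
  qed
  then show ?thesis by (simp add: xs null_walk_def)
qed

lemma foldl_push_power_word: "foldl push \<sigma> (power_word xs m) = (act (steps (u # xs)) ^^ m) \<sigma>"
  unfolding act_power[symmetric] act_def power_word_def by (simp add: map_concat)

lemma irreducible_core_Nil: "irreducible_core s [] \<longleftrightarrow> bt_del\<^sup>*\<^sup>* s []"
  by (auto simp: irreducible_core_def elim: bt_del.cases)

lemma ln_one_minus_has_sum:
  fixes p :: real
  assumes "0 \<le> p" "p < 1"
  shows "((\<lambda>m. p ^ m / real m) has_sum - ln (1 - p)) {0<..}"
proof -
  have "(\<lambda>m. - ((- (- p)) ^ m) / real m) sums ln (1 + (- p))"
    using assms by (intro ln_series') auto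
  from sums_minus[OF this] have "(\<lambda>m. p ^ m / real m) sums - ln (1 - p)" by simp
  then have "((\<lambda>m. p ^ m / real m) has_sum - ln (1 - p)) UNIV"
    using assms by (intro sums_nonneg_imp_has_sum) auto
  then show ?thesis
    by (rule has_sum_cong_neutral[THEN iffD1, rotated -1]) auto
qed

context symmetric_weights begin

definition tb_words :: "nat list set" where
  "tb_words = {xs. xs \<noteq> [] \<and> walk_from R (last xs) xs \<and> null_walk (last xs) xs}"

lemma rotate_tb_words: "xs \<in> tb_words \<Longrightarrow> rotate k xs \<in> tb_words"
proof (induction k)
  case (Suc k)
  have "rotate1 ys \<in> tb_words" if "ys \<in> tb_words" for ys
  proof -
    from that obtain a zs where ys: "ys = a # zs" by (cases ys) (auto simp: tb_words_def)
    have "walk_from R (last (rotate1 ys)) (rotate1 ys)"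
      using that by (auto simp: tb_words_def ys walk_from_append split: if_splits)
    then show ?thesis using that null_walk_rotate1 by (auto simp: tb_words_def)
  qed
  with Suc show ?case by simp
qed simp

text \<open>Powers of the identity action are the identity; the converse is torsion-freeness, with
  loops excluded by the zero diagonal.\<close>

lemma power_word_tb_words:
  assumes "xs \<noteq> []" "m > 0"
  shows "power_word xs m \<in> tb_words \<longleftrightarrow> xs \<in> tb_words"
proof -
  let ?u = "last xs" and ?s = "steps (last xs # xs)"
  have path: "walk_from R ?u (power_word xs l)" if "walk_from R ?u xs" for l
    by (induction l) (use that assms in \<open>auto simp: power_word_Suc walk_from_append\<close>)
  have path': "walk_from R ?u xs" if "walk_from R ?u (power_word xs m)"
    using that assms by (cases m) (auto simp: power_word_Suc walk_from_append)
  have chain: "chain ?u ?s ?u" using chain_steps[of ?u xs] assms by simp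
  have null: "null_walk ?u (power_word xs m) \<longleftrightarrow> (\<forall>\<sigma>\<in>lifts ?u. (act ?s ^^ m) \<sigma> = \<sigma>)"
    by (simp add: null_walk_def foldl_push_power_word[of _ xs _ ?u])
  have "null_walk ?u (power_word xs m) \<longleftrightarrow> null_walk ?u xs" if "walk_from R ?u xs"
  proof
    assume "null_walk ?u xs"
    then have *: "act ?s \<sigma> = \<sigma>" if "\<sigma> \<in> lifts ?u" for \<sigma>
      using that by (simp add: null_walk_def act_steps)
    have "(act ?s ^^ l) \<sigma> = \<sigma>" if "\<sigma> \<in> lifts ?u" for \<sigma> l
      by (induction l) (auto simp: * that)
    then show "null_walk ?u (power_word xs m)" by (simp add: null)
  next
    assume "null_walk ?u (power_word xs m)"
    moreover have "\<forall>e\<in>set ?s. fst e \<noteq> snd e"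
      using that adjD(3) unfolding walk_from_iff_steps by fastforce
    ultimately have "\<forall>\<sigma>\<in>lifts ?u. act ?s \<sigma> = \<sigma>"
      using act_torsion_free[OF chain _ assms(2)] null by blast
    then show "null_walk ?u xs" by (simp add: null_walk_def act_steps)
  qed
  then show ?thesis
    using assms path path' by (auto simp: tb_words_def last_power_word)
qed

text \<open>Every deleted pair, inner or wrapping, contributes
  \<open>R $$ (i, j) * R $$ (j, i)\<close>, a square by symmetry. Nonnegative weights later permit
  unconditional rearrangement.\<close>

lemma prod_steps_nonneg:
  assumes "bt_del\<^sup>*\<^sup>* s []" "\<forall>(i, j)\<in>set s. adj R i j"
  shows "prod_list (map (($$) R) s) \<ge> 0"
  using assms
proof (induction rule: converse_rtranclp_induct)
  case (step s t)
  have sq: "R $$ (i, j) * R $$ (j, i) \<ge> 0" if "(i, j) \<in> set s" for i j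
    using that step.prems adjD(5)[of i j] by auto
  from step.hyps(1) show ?case
  proof cases
    case (inner a i j b)
    have "prod_list (map (($$) R) s) = (R $$ (i, j) * R $$ (j, i)) * prod_list (map (($$) R) t)"
      by (simp add: inner)
    moreover have "prod_list (map (($$) R) t) \<ge> 0"
      using inner step.prems by (intro step.IH) auto
    moreover have "R $$ (i, j) * R $$ (j, i) \<ge> 0" using inner by (intro sq) auto
    ultimately show ?thesis by (simp only: mult_nonneg_nonneg)
  next
    case (wrap j i)
    have "prod_list (map (($$) R) s) = (R $$ (i, j) * R $$ (j, i)) * prod_list (map (($$) R) t)"
      by (simp add: wrap)
    moreover have "prod_list (map (($$) R) t) \<ge> 0"
      using wrap step.prems by (intro step.IH) auto
    moreover have "R $$ (i, j) * R $$ (j, i) \<ge> 0" using wrap by (intro sq) auto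
    ultimately show ?thesis by (simp only: mult_nonneg_nonneg)
  qed
qed simp

lemma cyclic_weight_nonneg: "xs \<in> tb_words \<Longrightarrow> cyclic_weight R xs \<ge> 0"
  by (auto simp: tb_words_def cyclic_weight_def weight_eq_prod_steps walk_from_iff_steps
      null_walk_iff_bt_del intro!: prod_steps_nonneg)

text \<open>The top of the final stack is the last vertex of the walk, so reaching
  \<open>[i]\<close> already forces the walk to close at \<open>i\<close>.\<close>

lemma returns_eq_tb_words:
  assumes "L > 0"
  shows "returns i L [i] = {xs \<in> tb_words. length xs = L \<and> last xs = i}"
proof -
  have "last xs = i" if "xs \<noteq> []" "foldl push [i] xs = [i]" for xs
    using hd_foldl_push[OF that(1), of "[i]"] that(2) by simp
  then show ?thesis
    using assms by (auto simp: returns_def tb_words_def null_walk_iff_foldl)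
qed

lemma last_tb_word: "xs \<in> tb_words \<Longrightarrow> last xs < n"
  using walk_from_subset last_in_set unfolding tb_words_def by blast

lemma finite_tb_words_length: "finite {xs \<in> tb_words. length xs = L}"
  by (rule finite_subset[OF _ finite_lists_length_eq[of "{..<n}" L]])
     (auto simp: tb_words_def dest: walk_from_subset)

lemma sum_return_weight:
  assumes "L > 0"
  shows "(\<Sum>i<n. return_weight R i L [i]) = (\<Sum>xs | xs \<in> tb_words \<and> length xs = L. cyclic_weight R xs)"
proof -
  have eq: "{xs \<in> tb_words. length xs = L} = (\<Union>i<n. returns i L [i])"
    using assms by (auto simp: returns_eq_tb_words last_tb_word)
  have "(\<Sum>xs\<in>{xs \<in> tb_words. length xs = L}. cyclic_weight R xs) =
     (\<Sum>i<n. \<Sum>xs\<in>returns i L [i]. cyclic_weight R xs)"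
    unfolding eq
    by (rule sum.UNION_disjoint) (use assms in \<open>auto simp: finite_returns, auto simp: returns_eq_tb_words\<close>)
  also have "\<dots> = (\<Sum>i<n. \<Sum>xs\<in>returns i L [i]. weight R i xs)"
    using assms by (intro sum.cong refl) (auto simp: returns_eq_tb_words cyclic_weight_def)
  finally show ?thesis by (simp add: return_weight_eq_sum)
qed

lemma orbit_of_tb_word:
  assumes "xs \<in> tb_words" "w \<in> orbit_of (cyclic_walk xs)"
  obtains k where "w = cyclic_walk (rotate k xs)"
  using assms by (auto simp: tb_words_def orbit_of_cyclic_walk)

lemma orbit_rep_in: "xs \<noteq> [] \<Longrightarrow> orbit_rep (orbit_of (cyclic_walk xs)) \<in> orbit_of (cyclic_walk xs)"
  unfolding orbit_rep_def by (rule someI[of _ "cyclic_walk xs"]) (rule cyclic_walk_in_orbit_of)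

text \<open>\<open>orbit_rep\<close> picks an unspecified rotation, which is harmless because
  contractibility is invariant under rotation.\<close>

lemma tb_orbits_eq: "tb_orbits R = (\<lambda>xs. orbit_of (cyclic_walk xs)) ` {xs \<in> tb_words. primitive_word xs}"
proof -
  have "orbits R = {orbit_of (cyclic_walk xs) | xs. walk_from R (last xs) xs \<and> primitive_word xs}"
    unfolding orbits_def
    by (metis (no_types, opaque_lifting) closed_walk_iff primitive_walk_cyclic_walk primitive_walk_def)
  moreover have "totally_backtracking (orbit_of (cyclic_walk xs)) \<longleftrightarrow> null_walk (last xs) xs"
    if xs: "walk_from R (last xs) xs" "primitive_word xs" for xs
  proof -
    have ne: "xs \<noteq> []" using xs by (simp add: primitive_word_def)
    obtain k where k: "orbit_rep (orbit_of (cyclic_walk xs)) = cyclic_walk (rotate k xs)"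
      using orbit_rep_in[OF ne] ne by (auto simp: orbit_of_cyclic_walk_range)
    have "totally_backtracking (orbit_of (cyclic_walk xs)) \<longleftrightarrow> null_walk (last (rotate k xs)) (rotate k xs)"
      by (simp add: totally_backtracking_def k irreducible_core_Nil null_walk_iff_bt_del)
         (simp add: cyclic_walk_def)
    also have "\<dots> \<longleftrightarrow> null_walk (last xs) xs"
    proof -
      have rot: "null_walk (last (rotate j ys)) (rotate j ys)" if "ys \<noteq> []" "null_walk (last ys) ys" for j ys
        by (induction j) (use that null_walk_rotate1 in auto)
      obtain j where "rotate j (rotate k xs) = xs" using rotate_back by blast
      then show ?thesis using rot[of xs k] rot[of "rotate k xs" j] ne by auto
    qed
    finally show ?thesis .
  qed
  ultimately show ?thesis
    unfolding tb_orbits_def tb_words_def by (auto simp: primitive_word_def image_iff)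
qed

lemma orbit_weight_eq:
  assumes "xs \<in> tb_words"
  shows "orbit_weight R (orbit_of (cyclic_walk xs)) = cyclic_weight R xs"
proof -
  have ne: "xs \<noteq> []" using assms by (simp add: tb_words_def)
  obtain k where k: "orbit_rep (orbit_of (cyclic_walk xs)) = cyclic_walk (rotate k xs)"
    using orbit_rep_in[OF ne] ne by (auto simp: orbit_of_cyclic_walk_range)
  let ?ys = "rotate k xs"
  let ?s = "steps (last ?ys # ?ys)" and ?A = "{(i, j). adj R i j}"
  have "?ys \<in> tb_words" using rotate_tb_words[OF assms] .
  then have sub: "set ?s \<subseteq> ?A" by (auto simp: tb_words_def walk_from_iff_steps)
  have fin: "finite ?A"
    by (rule finite_subset[of _ "{..<n} \<times> {..<n}"]) (auto simp: adjD)
  have "orbit_weight R (orbit_of (cyclic_walk xs)) = (\<Prod>e\<in>?A. R $$ e ^ count_list ?s e)"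
    unfolding orbit_weight_def step_count_def k by (intro prod.cong) (auto simp: cyclic_walk_def)
  also have "\<dots> = prod_list (map (($$) R) ?s)"
    using prod_list_map_eq_prod_power[OF fin sub] by metis
  also have "\<dots> = cyclic_weight R ?ys"
    by (simp add: cyclic_weight_def weight_eq_prod_steps)
  finally show ?thesis by (simp add: cyclic_weight_rotate)
qed

end

section \<open>Sums over words, primitive words and orbits\<close>

context convergent_weights begin

text \<open>Otherwise all powers of \<open>xs\<close> would have weight at least 1. The other terms
  of the return weights are nonnegative, so this contradicts their exponential decay.\<close>

lemma cyclic_weight_less_1:
  assumes "xs \<in> tb_words"
  shows "cyclic_weight R xs < 1"
proof (rule ccontr)
  assume "\<not> ?thesis"
  then have ge: "cyclic_weight R xs \<ge> 1" by simp
  have ne: "xs \<noteq> []" and last: "last xs < n"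
    using assms last_tb_word by (auto simp: tb_words_def)
  have "c ^ m \<le> C" if m: "m > 0" for m
  proof -
    let ?ys = "power_word xs m" and ?i = "last xs"
    have ys: "?ys \<in> tb_words" using assms ne m by (simp add: power_word_tb_words)
    let ?L = "length ?ys"
    have L: "?L > 0" "m \<le> ?L" using ne m by (auto simp: Suc_leI)
    have "1 \<le> cyclic_weight R xs ^ m" using ge by (rule one_le_power)
    also have "\<dots> = weight R ?i ?ys" using ne m by (simp add: weight_power_word cyclic_weight_def)
    also have "\<dots> \<le> (\<Sum>zs\<in>returns ?i ?L [?i]. weight R ?i zs)"
    proof (rule member_le_sum)
      show "?ys \<in> returns ?i ?L [?i]"
        using ys L ne m by (simp add: returns_eq_tb_words last_power_word)
      fix zs assume "zs \<in> returns ?i ?L [?i] - {?ys}"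
      then show "0 \<le> weight R ?i zs"
        using cyclic_weight_nonneg[of zs] L(1) by (auto simp: returns_eq_tb_words cyclic_weight_def)
    qed (rule finite_returns)
    also have "\<dots> = return_weight R ?i ?L [?i]" by (simp add: return_weight_eq_sum)
    finally have "1 \<le> \<bar>return_weight R ?i ?L [?i]\<bar>" by simp
    then have "c ^ ?L \<le> \<bar>return_weight R ?i ?L [?i]\<bar> * c ^ ?L" using c by simp
    also have "\<dots> \<le> C" by (rule bound[OF last])
    finally have "c ^ ?L \<le> C" .
    moreover have "c ^ m \<le> c ^ ?L" using c L by (intro power_increasing) auto
    ultimately show ?thesis by simp
  qed
  moreover obtain m where "C < c ^ m" using real_arch_pow[OF c] by blast
  moreover have "c ^ m \<le> c ^ Suc m" using c by (intro power_increasing) auto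
  ultimately show False by (meson leD less_le_trans zero_less_Suc)
qed

text \<open>Words of a given length are finite in number, and nonnegativity turns the convergent
  series over lengths into an unconditional sum over words.\<close>

lemma tb_words_has_sum:
  "((\<lambda>xs. cyclic_weight R xs / length xs) has_sum ln (Z_bp R)) tb_words"
proof -
  let ?T = "\<lambda>L. {xs \<in> tb_words. length xs = L}"
  let ?f = "\<lambda>(L :: nat, xs). cyclic_weight R xs / length xs"
  let ?g = "\<lambda>L. (\<Sum>i<n. return_weight R i L [i]) / real L"
  have g: "?g L = (\<Sum>xs\<in>?T L. cyclic_weight R xs / length xs)" for L
    by (cases "L = 0") (auto simp: sum_return_weight sum_divide_distrib)
  have nonneg: "?g L \<ge> 0" for L
    unfolding g by (intro sum_nonneg divide_nonneg_nonneg) (auto simp: cyclic_weight_nonneg)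
  have G: "(?g has_sum ln (Z_bp R)) UNIV"
    using ln_Z_bp_sums nonneg by (rule sums_nonneg_imp_has_sum)
  have inner: "((\<lambda>xs. ?f (L, xs)) has_sum ?g L) (?T L)" for L
    unfolding g by (intro has_sum_finiteI finite_tb_words_length) simp
  have "(?f has_sum ln (Z_bp R)) (Sigma UNIV ?T)"
    using inner G
  proof (rule has_sum_SigmaI)
    show "?f summable_on Sigma UNIV ?T"
      using inner has_sum_imp_summable[OF G]
      by (rule summable_on_SigmaI) (auto simp: cyclic_weight_nonneg)
  qed
  then show ?thesis
    by (rule has_sum_reindex_bij_witness[where i = "\<lambda>xs. (length xs, xs)" and j = snd, THEN iffD1, rotated -1]) auto
qed

text \<open>Words are reindexed as unique powers of primitive ones; for a fixed root the powers form
  a logarithmic series.\<close>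

lemma primitive_words_has_sum:
  "((\<lambda>xs. - ln (1 - cyclic_weight R xs) / length xs) has_sum ln (Z_bp R)) {xs \<in> tb_words. primitive_word xs}"
proof -
  let ?P = "{xs \<in> tb_words. primitive_word xs}"
  let ?pow = "\<lambda>(xs, m). power_word xs m"
  let ?f = "\<lambda>(xs, m). cyclic_weight R xs ^ m / m / length xs"
  have bij: "bij_betw ?pow (?P \<times> {0<..}) tb_words"
  proof (rule bij_betw_imageI)
    show "inj_on ?pow (?P \<times> {0<..})"
      by (auto simp: inj_on_def dest: primitive_root_unique)
    show "?pow ` (?P \<times> {0<..}) = tb_words"
    proof (intro equalityI subsetI)
      fix xs assume xs: "xs \<in> tb_words"
      then have "xs \<noteq> []" by (simp add: tb_words_def)
      then obtain u m where u: "primitive_word u" "m > 0" "xs = power_word u m"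
        using ex_primitive_root by blast
      then have "u \<in> tb_words" using xs power_word_tb_words[of u m] by (auto simp: primitive_word_def)
      then show "xs \<in> ?pow ` (?P \<times> {0<..})" using u by force
    qed (auto simp: power_word_tb_words primitive_word_def)
  qed
  have "((\<lambda>x. cyclic_weight R (?pow x) / length (?pow x)) has_sum ln (Z_bp R)) (?P \<times> {0<..})"
    using has_sum_reindex_bij_betw[OF bij, of "\<lambda>xs. cyclic_weight R xs / length xs"] tb_words_has_sum by simp
  then have "(?f has_sum ln (Z_bp R)) (?P \<times> {0<..})"
    by (rule has_sum_cong[THEN iffD1, rotated])
       (auto simp: cyclic_weight_power_word primitive_word_def)
  then show ?thesis
  proof (rule has_sum_Sigma')
    fix xs assume "xs \<in> ?P"
    then have "((\<lambda>m. cyclic_weight R xs ^ m / real m) has_sum - ln (1 - cyclic_weight R xs)) {0<..}"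
      by (intro ln_one_minus_has_sum) (auto simp: cyclic_weight_nonneg cyclic_weight_less_1)
    from has_sum_divide_const[OF this]
    show "((\<lambda>m. ?f (xs, m)) has_sum - ln (1 - cyclic_weight R xs) / length xs) {0<..}" by simp
  qed
qed

text \<open>Orbits partition the primitive words. The weight is constant on an orbit, and its
  \<open>length xs\<close> members cancel the division by the length.\<close>

lemma orbits_has_sum:
  "((\<lambda>l. - ln (1 - orbit_weight R l)) has_sum ln (Z_bp R)) (tb_orbits R)"
proof -
  let ?P = "{xs \<in> tb_words. primitive_word xs}"
  let ?h = "\<lambda>xs. - ln (1 - cyclic_weight R xs) / length xs"
  have mem: "\<exists>ys\<in>?P. w = cyclic_walk ys \<and> l = orbit_of (cyclic_walk ys)"
    if lw: "l \<in> tb_orbits R" "w \<in> l" for l w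
  proof -
    from lw obtain xs where xs: "xs \<in> ?P" "l = orbit_of (cyclic_walk xs)" by (auto simp: tb_orbits_eq)
    then have ne: "xs \<noteq> []" by (simp add: primitive_word_def)
    obtain k where k: "w = cyclic_walk (rotate k xs)"
      using lw(2) unfolding xs(2) orbit_of_cyclic_walk_range[OF ne] by auto
    show ?thesis
      using k xs ne rotate_tb_words primitive_word_rotate
      by (intro bexI[of _ "rotate k xs"]) (auto simp: orbit_of_rotate)
  qed
  have self: "cyclic_walk xs \<in> orbit_of (cyclic_walk xs)" if "xs \<in> ?P" for xs
    using that by (intro cyclic_walk_in_orbit_of) (simp add: primitive_word_def)
  have "((\<lambda>(l, w). ?h (tl w)) has_sum ln (Z_bp R)) (SIGMA l:tb_orbits R. l)"
    using primitive_words_has_sum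
  proof (rule has_sum_reindex_bij_witness[where j = "\<lambda>xs. (orbit_of (cyclic_walk xs), cyclic_walk xs)"
        and i = "\<lambda>(l, w). tl w", THEN iffD1, rotated -1])
    fix x assume "x \<in> (SIGMA l:tb_orbits R. l)"
    then obtain l w where x: "x = (l, w)" "l \<in> tb_orbits R" "w \<in> l" by auto
    from mem[OF x(2,3)] obtain ys where "ys \<in> ?P" "w = cyclic_walk ys" "l = orbit_of (cyclic_walk ys)" by blast
    then show "(orbit_of (cyclic_walk (case x of (l, w) \<Rightarrow> tl w)), cyclic_walk (case x of (l, w) \<Rightarrow> tl w)) = x"
      "(case x of (l, w) \<Rightarrow> tl w) \<in> ?P"
      by (auto simp: x)
  qed (use self in \<open>auto simp: tb_orbits_eq\<close>)
  then show ?thesis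
  proof (rule has_sum_Sigma')
    fix l assume l: "l \<in> tb_orbits R"
    then obtain xs where xs: "xs \<in> ?P" "l = orbit_of (cyclic_walk xs)" by (auto simp: tb_orbits_eq)
    have "?h (tl w) = - ln (1 - orbit_weight R l) / length xs" if w: "w \<in> l" for w
    proof -
      from orbit_of_tb_word[of xs w] xs w obtain k where k: "w = cyclic_walk (rotate k xs)" by auto
      then show ?thesis using xs by (simp add: orbit_weight_eq cyclic_weight_rotate)
    qed
    then have "(\<Sum>w\<in>l. ?h (tl w)) = card l * (- ln (1 - orbit_weight R l) / length xs)" by simp
    also have "\<dots> = - ln (1 - orbit_weight R l)"
      using xs by (auto simp: card_orbit_of primitive_word_def)
    finally show "((\<lambda>w. case (l, w) of (l, w) \<Rightarrow> ?h (tl w)) has_sum - ln (1 - orbit_weight R l)) l"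
      using xs card_orbit_of(2)[of xs] by (simp add: has_sum_finiteI)
  qed
qed

lemma orbits_has_prod: "has_prod_set (\<lambda>l. inverse (1 - orbit_weight R l)) (Z_bp R) (tb_orbits R)"
proof -
  have pos: "0 < 1 - orbit_weight R l" if "l \<in> tb_orbits R" for l
    using that by (auto simp: tb_orbits_eq orbit_weight_eq cyclic_weight_less_1)
  have "((\<lambda>F. exp (\<Sum>l\<in>F. - ln (1 - orbit_weight R l))) \<longlongrightarrow> exp (ln (Z_bp R))) (finite_subsets_at_top (tb_orbits R))"
    using orbits_has_sum unfolding has_sum_def by (rule tendsto_exp)
  moreover have "exp (ln (Z_bp R)) = Z_bp R" by (simp add: Z_bp_eq)
  moreover have ev: "eventually (\<lambda>F. exp (\<Sum>l\<in>F. - ln (1 - orbit_weight R l)) = (\<Prod>l\<in>F. inverse (1 - orbit_weight R l)))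
     (finite_subsets_at_top (tb_orbits R))"
  proof (rule eventually_finite_subsets_at_top_weakI)
    fix F assume F: "finite F" "F \<subseteq> tb_orbits R"
    then show "exp (\<Sum>l\<in>F. - ln (1 - orbit_weight R l)) = (\<Prod>l\<in>F. inverse (1 - orbit_weight R l))"
      using pos unfolding exp_sum[OF F(1)] by (intro prod.cong) (auto simp: exp_minus)
  qed
  ultimately show ?thesis unfolding has_prod_set_def using tendsto_cong[OF ev] by simp
qed

end

theorem theorem2:
  fixes R :: "real mat" and n :: nat
  assumes "R \<in> carrier_mat n n"
    and "R\<^sup>T = R"
    and "\<forall>i<n. R $$ (i,i) = 0"
    and "spectral_radius (map_mat complex_of_real (abs_mat R)) < 1"
  shows "has_prod_set (\<lambda>l. inverse (1 - orbit_weight R l)) (Z_bp R) (tb_orbits R)"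
proof -
  interpret symmetric_weights R n
    by standard (use assms in auto)
  obtain c C where c: "c > 1" "\<And>i L. i < n \<Longrightarrow> \<bar>return_weight R i L [i]\<bar> * c ^ L \<le> C"
    using return_weight_bound[OF assms(4)] by blast
  interpret convergent_weights R n c C
    by standard (use c in auto)
  show ?thesis by (rule orbits_has_prod)
qed

end
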